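(* Let $g\in\mathbb Z_{>0}$ and $x=2g+1$. Let $(G,\rho)$ have vertices $v,z,w$, two edges $c_1,c_2$ joining $v$ and $z$, and $x$ edges $f_1,\dots,f_x$ joining $z$ and $w$, where $c_1,c_2$ are consecutive in $\rho_z$ and the restriction of $\rho_z$ to $\{f_1,\dots,f_x\}$ equals $\rho_w$. Let $(G',\rho')$ have the same vertices $v,z,w$, one edge $c$ joining $v$ and $z$, and $2x$ edges $h_1,\dots,h_{2x}$ joining $z$ and $w$, where the restriction of $\rho'_z$ to $\{h_1,\dots,h_{2x}\}$ equals $\rho'_w$. Then: $\operatorname{Pic}^0(G)\cong\operatorname{Pic}^0(G')$; the set $V_{gen}=\{v,w\}$ satisfies Properties 1 and 2 below, so the map $\hat\gamma:\operatorname{Pic}^0(G)\to\operatorname{Pic}^0(G')$ induced by the identity on $V_{gen}$ is an isomorphism; there is a bijection $\varphi:\mathcal T(G)\to\mathcal T(G')$ such that for every vertex $u\in\{v,z,w\}$ and for $\alpha$ either the rotor routing process or the Bernardi process, $\varphi(\alpha_u^{G}(S,T))=\alpha_u^{G'}(\hat\gamma(S),\varphi(T))$ for all $S\in\operatorname{Pic}^0(G)$, $T\in\mathcal T(G)$; and the genus of $(G,\rho)$ is $g$ while the genus of $(G',\rho')$ is $2g$.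
   Context: Graphs are finite, connected, loopless, possibly with multiple edges; $\mathcal T(G)$ is the set of spanning trees. A ribbon graph assigns to each vertex $u$ a cyclic order $\rho_u$ on incident edges. $\operatorname{Pic}^0$ is degree-zero integer chip configurations modulo firings (firing $u$ sends one chip from $u$ along each incident edge); $\operatorname{Pic}^k$ likewise for degree $k$. For graphs $G,G'$ on the same vertex set and $V_{gen}\subseteq V(G)$: Property 1: every element of $\operatorname{Pic}^0(G)$ and of $\operatorname{Pic}^0(G')$ has a representative with no chips outside $V_{gen}$; Property 2: two degree-zero configurations with no chips outside $V_{gen}$ are equivalent in $G$ iff equivalent in $G'$. Then $\hat\gamma(S)$ is the class in $\operatorname{Pic}^0(G')$ of any representative of $S$ supported on $V_{gen}$ (same chip counts). Rotor routing torsor $r_u$: for $S$, $T$, choose a representative of $S$ nonnegative away from $u$; orient $T$ towards $u$ giving each other vertex a rotor; while some vertex $y\ne u$ has positive chips, advance its rotor to the next edge of $\rho_y$ and send a chip along it; when all vertices but $u$ have zero chips, the rotors form $r_u(S,T)$. Bernardi torsor $\beta_u$: with half-edges $(e,y)$, for $T$ start at $(e_0,u)$, $e_0$ a fixed edge at $u$; at $(e',y')$: if $e'\in T$ with other endpoint $y''$, move to $(e'',y'')$ with $e''$ following $e'$ in $\rho_{y''}$; if $e'\notin T$, move to $(\tilde e,y')$ with $\tilde e$ following $e'$ in $\rho_{y'}$, placing a chip on $y'$ if the other half-edge of $e'$ was not yet visited; stop on return to $(e_0,u)$. The resulting divisors $D_T$ of degree $|E|-|V|+1$ are in bijection with $\operatorname{Pic}^{|E|-|V|+1}$,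 and $\beta_u(S,T)$ is the unique $T'$ with $[D_{T'}]=[D_T]+S$. Genus: a cycle is a closed walk which, entering $y$ along $e$, exits along the edge following $e$ in $\rho_y$; the genus $g$ satisfies $2g=2-|V|+|E|-\operatorname{cyc}$, $\operatorname{cyc}$ the number of cycles. *)

theory Defs
  imports Main
begin

text \<open>A ribbon graph: vertex set, edge set, endpoint map (edges are unoriented; the
order of the pair is irrelevant), and for each vertex a rotation (cyclic successor
function on incident edges).\<close>

record ('v, 'e) rgraph =
  verts :: "'v set"
  edges :: "'e set"
  ends  :: "'e \<Rightarrow> 'v \<times> 'v"
  rot   :: "'v \<Rightarrow> 'e \<Rightarrow> 'e"

definition endpts :: "('v, 'e) rgraph \<Rightarrow> 'e \<Rightarrow> 'v set" where
  "endpts G e = {fst (ends G e), snd (ends G e)}"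

definition inc :: "('v, 'e) rgraph \<Rightarrow> 'v \<Rightarrow> 'e set" where
  "inc G y = {e \<in> edges G. y \<in> endpts G e}"

definition oth :: "('v, 'e) rgraph \<Rightarrow> 'e \<Rightarrow> 'v \<Rightarrow> 'v" where
  "oth G e y = (if fst (ends G e) = y then snd (ends G e) else fst (ends G e))"

definition adjrel :: "('v, 'e) rgraph \<Rightarrow> 'e set \<Rightarrow> ('v \<times> 'v) set" where
  "adjrel G F = {(a, b). \<exists>e\<in>F. ends G e = (a, b) \<or> ends G e = (b, a)}"

definition reach :: "('v, 'e) rgraph \<Rightarrow> 'e set \<Rightarrow> 'v \<Rightarrow> 'v \<Rightarrow> bool" where
  "reach G F a b \<longleftrightarrow> (a, b) \<in> (adjrel G F)\<^sup>*"

definition ribbon :: "('v, 'e) rgraph \<Rightarrow> bool" where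
  "ribbon G \<longleftrightarrow> finite (verts G) \<and> finite (edges G)
     \<and> (\<forall>e\<in>edges G. fst (ends G e) \<noteq> snd (ends G e)
                      \<and> fst (ends G e) \<in> verts G \<and> snd (ends G e) \<in> verts G)
     \<and> (\<forall>a\<in>verts G. \<forall>b\<in>verts G. reach G (edges G) a b)
     \<and> (\<forall>y\<in>verts G. bij_betw (rot G y) (inc G y) (inc G y)
          \<and> (\<forall>e\<in>inc G y. \<forall>e'\<in>inc G y. \<exists>n. (rot G y ^^ n) e = e'))"

definition restrict_rot :: "('e \<Rightarrow> 'e) \<Rightarrow> 'e set \<Rightarrow> 'e \<Rightarrow> 'e" where
  "restrict_rot r A e = (r ^^ (LEAST n. n > 0 \<and> (r ^^ n) e \<in> A)) e"

definition sptrees :: "('v, 'e) rgraph \<Rightarrow> 'e set set" where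
  "sptrees G = {T. T \<subseteq> edges G \<and> card T = card (verts G) - 1
                   \<and> (\<forall>a\<in>verts G. \<forall>b\<in>verts G. reach G T a b)}"

definition config :: "('v, 'e) rgraph \<Rightarrow> ('v \<Rightarrow> int) \<Rightarrow> bool" where
  "config G D \<longleftrightarrow> (\<forall>x. x \<notin> verts G \<longrightarrow> D x = 0)"

definition cdeg :: "('v, 'e) rgraph \<Rightarrow> ('v \<Rightarrow> int) \<Rightarrow> int" where
  "cdeg G D = sum D (verts G)"

text \<open>net number of chips leaving x when every vertex u fires f u times\<close>
definition lap :: "('v, 'e) rgraph \<Rightarrow> ('v \<Rightarrow> int) \<Rightarrow> 'v \<Rightarrow> int" where
  "lap G f x = (\<Sum>e\<in>inc G x. f x - f (oth G e x))"

definition linequiv :: "('v, 'e) rgraph \<Rightarrow> ('v \<Rightarrow> int) \<Rightarrow> ('v \<Rightarrow> int) \<Rightarrow> bool" where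
  "linequiv G D D' \<longleftrightarrow> (\<exists>f. \<forall>x\<in>verts G. D' x = D x - lap G f x)"

definition pcls :: "('v, 'e) rgraph \<Rightarrow> ('v \<Rightarrow> int) \<Rightarrow> ('v \<Rightarrow> int) set" where
  "pcls G D = {D'. config G D' \<and> linequiv G D D'}"

definition Pic :: "('v, 'e) rgraph \<Rightarrow> int \<Rightarrow> ('v \<Rightarrow> int) set set" where
  "Pic G k = pcls G ` {D. config G D \<and> cdeg G D = k}"

abbreviation Pic0 :: "('v, 'e) rgraph \<Rightarrow> ('v \<Rightarrow> int) set set" where
  "Pic0 G \<equiv> Pic G 0"

definition pic_add :: "('v \<Rightarrow> int) set \<Rightarrow> ('v \<Rightarrow> int) set \<Rightarrow> ('v \<Rightarrow> int) set" where
  "pic_add A B = {(\<lambda>y. a y + b y) | a b. a \<in> A \<and> b \<in> B}"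

definition pic_iso :: "('v, 'e) rgraph \<Rightarrow> ('v, 'f) rgraph
                        \<Rightarrow> (('v \<Rightarrow> int) set \<Rightarrow> ('v \<Rightarrow> int) set) \<Rightarrow> bool" where
  "pic_iso G G' h \<longleftrightarrow> bij_betw h (Pic0 G) (Pic0 G')
      \<and> (\<forall>A\<in>Pic0 G. \<forall>B\<in>Pic0 G. h (pic_add A B) = pic_add (h A) (h B))"

definition supported_on :: "'v set \<Rightarrow> ('v \<Rightarrow> int) \<Rightarrow> bool" where
  "supported_on W D \<longleftrightarrow> (\<forall>x. x \<notin> W \<longrightarrow> D x = 0)"

definition property1 :: "('v, 'e) rgraph \<Rightarrow> ('v, 'f) rgraph \<Rightarrow> 'v set \<Rightarrow> bool" where
  "property1 G G' Vg \<longleftrightarrow> (\<forall>A\<in>Pic0 G. \<exists>D\<in>A. supported_on Vg D)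
                        \<and> (\<forall>A\<in>Pic0 G'. \<exists>D\<in>A. supported_on Vg D)"

definition property2 :: "('v, 'e) rgraph \<Rightarrow> ('v, 'f) rgraph \<Rightarrow> 'v set \<Rightarrow> bool" where
  "property2 G G' Vg \<longleftrightarrow> (\<forall>D1 D2. supported_on Vg D1 \<and> supported_on Vg D2
        \<and> sum D1 Vg = 0 \<and> sum D2 Vg = 0
        \<longrightarrow> (linequiv G D1 D2 \<longleftrightarrow> linequiv G' D1 D2))"

definition gam :: "('v, 'e) rgraph \<Rightarrow> ('v, 'f) rgraph \<Rightarrow> 'v set
                   \<Rightarrow> ('v \<Rightarrow> int) set \<Rightarrow> ('v \<Rightarrow> int) set" where
  "gam G G' Vg S = pcls G' (SOME D. D \<in> S \<and> supported_on Vg D)"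

text \<open>orientation of a spanning tree towards u: the rotor at y is the tree edge at y
whose removal disconnects y from u\<close>
definition torient :: "('v, 'e) rgraph \<Rightarrow> 'e set \<Rightarrow> 'v \<Rightarrow> 'v \<Rightarrow> 'e" where
  "torient G T u y = (THE e. e \<in> T \<and> e \<in> inc G y \<and> \<not> reach G (T - {e}) y u)"

definition rstep :: "('v, 'e) rgraph \<Rightarrow> 'v
     \<Rightarrow> (('v \<Rightarrow> int) \<times> ('v \<Rightarrow> 'e)) \<Rightarrow> (('v \<Rightarrow> int) \<times> ('v \<Rightarrow> 'e)) \<Rightarrow> bool" where
  "rstep G u s s' \<longleftrightarrow> (\<exists>y\<in>verts G. y \<noteq> u \<and> fst s y > 0 \<and>
      (let e = rot G y (snd s y); y' = oth G e y in
       s' = ((fst s)(y := fst s y - 1, y' := fst s y' + 1), (snd s)(y := e))))"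

definition rotor_rel :: "('v, 'e) rgraph \<Rightarrow> 'v \<Rightarrow> ('v \<Rightarrow> int) set \<Rightarrow> 'e set \<Rightarrow> 'e set \<Rightarrow> bool" where
  "rotor_rel G u S T T' \<longleftrightarrow> (\<exists>D. D \<in> S \<and> (\<forall>y\<in>verts G - {u}. D y \<ge> 0) \<and>
      (\<exists>c r. (rstep G u)\<^sup>*\<^sup>* (D, torient G T u) (c, r)
             \<and> (\<forall>y\<in>verts G - {u}. c y = 0) \<and> T' = r ` (verts G - {u})))"

definition rotor :: "('v, 'e) rgraph \<Rightarrow> 'v \<Rightarrow> ('v \<Rightarrow> int) set \<Rightarrow> 'e set \<Rightarrow> 'e set" where
  "rotor G u S T = (SOME T'. rotor_rel G u S T T')"

definition bstep :: "('v, 'e) rgraph \<Rightarrow> 'e set \<Rightarrow> 'e \<times> 'v \<Rightarrow> 'e \<times> 'v" where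
  "bstep G T h = (let e = fst h; y = snd h in
     if e \<in> T then (rot G (oth G e y) e, oth G e y) else (rot G y e, y))"

definition bpath :: "('v, 'e) rgraph \<Rightarrow> 'e set \<Rightarrow> 'v \<Rightarrow> 'e \<Rightarrow> nat \<Rightarrow> 'e \<times> 'v" where
  "bpath G T u e0 k = (bstep G T ^^ k) (e0, u)"

definition blen :: "('v, 'e) rgraph \<Rightarrow> 'e set \<Rightarrow> 'v \<Rightarrow> 'e \<Rightarrow> nat" where
  "blen G T u e0 = (LEAST n. n > 0 \<and> bpath G T u e0 n = (e0, u))"

text \<open>the Bernardi divisor D_T: a chip at y for each step at a non-tree half-edge (e,y)
whose other half-edge has not yet been visited\<close>
definition bdiv :: "('v, 'e) rgraph \<Rightarrow> 'e set \<Rightarrow> 'v \<Rightarrow> 'e \<Rightarrow> 'v \<Rightarrow> int" where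
  "bdiv G T u e0 y = int (card {k. k < blen G T u e0 \<and> snd (bpath G T u e0 k) = y
        \<and> fst (bpath G T u e0 k) \<notin> T
        \<and> (fst (bpath G T u e0 k), oth G (fst (bpath G T u e0 k)) y)
             \<notin> bpath G T u e0 ` {..<k}})"

definition bern :: "('v, 'e) rgraph \<Rightarrow> 'v \<Rightarrow> 'e \<Rightarrow> ('v \<Rightarrow> int) set \<Rightarrow> 'e set \<Rightarrow> 'e set" where
  "bern G u e0 S T = (THE T'. T' \<in> sptrees G \<and>
      pcls G (bdiv G T' u e0) = pic_add (pcls G (bdiv G T u e0)) S)"

definition darts :: "('v, 'e) rgraph \<Rightarrow> ('e \<times> 'v) set" where
  "darts G = {(e, y). e \<in> edges G \<and> y \<in> endpts G e}"

text \<open>dart (e,y) = walk entering y along e; next dart exits along the successor of e\<close>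
definition fperm :: "('v, 'e) rgraph \<Rightarrow> 'e \<times> 'v \<Rightarrow> 'e \<times> 'v" where
  "fperm G d = (let e' = rot G (snd d) (fst d) in (e', oth G e' (snd d)))"

definition cyc :: "('v, 'e) rgraph \<Rightarrow> nat" where
  "cyc G = card ((\<lambda>d. {(fperm G ^^ n) d | n. True}) ` darts G)"

definition has_genus :: "('v, 'e) rgraph \<Rightarrow> int \<Rightarrow> bool" where
  "has_genus G g \<longleftrightarrow> 2 * g = 2 - int (card (verts G)) + int (card (edges G)) - int (cyc G)"

end

theory Submission
  imports Defs
begin

text \<open>
  Both graphs are chains \<open>v = z = w\<close> of two bundles of \<open>m\<close> and \<open>n\<close> parallel edges, with
  \<open>(m, n) = (2, x)\<close> and \<open>(1, 2x)\<close>, whose rotation at \<open>z\<close> runs once through the first bundle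
  \<open>C\<close> and then once through the second bundle \<open>F\<close>. Spanning trees are the pairs
  \<open>{C i, F j}\<close>, and a divisor class of given degree is determined by its number of chips at \<open>v\<close>
  modulo \<open>m\<close> and at \<open>w\<close> modulo \<open>n\<close>. In these coordinates each of the six torsors acts by
  translations \<open>(i, j) \<mapsto> (i \<plusminus> D v, j \<plusminus> D w)\<close> with signs that depend only on the root and
  the process. Every class is represented by \<open>k (v - w)\<close>, so by the Chinese remainder
  theorem the two actions correspond under \<open>(k mod 2, k mod x) \<mapsto> k mod 2x\<close>; where the signs
  for \<open>C\<close> and \<open>F\<close> do not match up this costs nothing, since signs are invisible modulo 1 and 2.
\<close>

section \<open>Cyclic sequences\<close>

text \<open>On the class of \<open>k (v - w)\<close> a root in \<open>{v, w}\<close> moves both tree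
  indices by \<open>k\<close> in the same direction, because the chip counts at \<open>v\<close> and
  \<open>w\<close> are opposite and so are the two signs. At the root \<open>z\<close> the signs
  agree and the indices move apart, to \<open>i + k\<close>, \<open>j - k\<close> for rotor routing
  and to \<open>i - k\<close>, \<open>j + k\<close> for Bernardi; only the size 2 or 1 of the first
  bundle brings them together again. Oddness of \<open>x\<close> enters twice: 2 and
  \<open>x\<close> are coprime, so that the diagonal index pairs exhaust the trees, and the first
  graph gets exactly two faces. The second graph has two faces as well, since \<open>2 x\<close> is
  even, and Euler's formula then gives the genera \<open>(x - 1) / 2 = g\<close> and
  \<open>x - 1 = 2 g\<close>, although the groups and torsors correspond. A further obstacle is that
  the given numbering of the edges between \<open>z\<close> and \<open>w\<close> is unrelated to the
  rotations. They are renumbered along the rotation at \<open>w\<close>, starting with the edge that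
  follows the first bundle at \<open>z\<close>.\<close>

lemma funpow_cyclic:
  fixes pos :: "'a \<Rightarrow> int"
  assumes closed: "\<And>d. d \<in> A \<Longrightarrow> f d \<in> A"
    and range: "\<And>d. d \<in> A \<Longrightarrow> pos d \<in> {0..<L}"
    and step: "\<And>d. d \<in> A \<Longrightarrow> pos (f d) = (pos d + 1) mod L"
    and "d \<in> A"
  shows "(f ^^ k) d \<in> A \<and> pos ((f ^^ k) d) = (pos d + int k) mod L"
proof (induction k)
  case 0
  then show ?case using range[OF \<open>d \<in> A\<close>] \<open>d \<in> A\<close> by simp
next
  case (Suc k)
  then show ?case
    by (simp add: closed step mod_simps algebra_simps)
qed

text \<open>\<open>pos\<close> turns \<open>f\<close> into addition of one modulo \<open>L\<close>,
  so the difference of two positions is the number of steps between them. Bernardi tours and faces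
  are handled by listing positions in this way instead of tracing iterates.\<close>

lemma funpow_cyclic_hits:
  fixes pos :: "'a \<Rightarrow> int"
  assumes closed: "\<And>d. d \<in> A \<Longrightarrow> f d \<in> A"
    and range: "\<And>d. d \<in> A \<Longrightarrow> pos d \<in> {0..<L}"
    and step: "\<And>d. d \<in> A \<Longrightarrow> pos (f d) = (pos d + 1) mod L"
    and inj: "inj_on pos A"
    and "d \<in> A" "d' \<in> A"
  shows "(f ^^ nat ((pos d' - pos d) mod L)) d = d'"
proof -
  have L: "L > 0" using range[OF \<open>d \<in> A\<close>] by auto
  let ?k = "nat ((pos d' - pos d) mod L)"
  have *: "(f ^^ ?k) d \<in> A \<and> pos ((f ^^ ?k) d) = (pos d + int ?k) mod L"
    by (rule funpow_cyclic[where A = A]) (use assms in auto)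
  have "(pos d + int ?k) mod L = pos d'"
    using L range[OF \<open>d' \<in> A\<close>] by (simp add: mod_simps)
  with * inj \<open>d' \<in> A\<close> show ?thesis by (metis inj_onD)
qed

lemma orbit_cyclic:
  fixes pos :: "'a \<Rightarrow> int"
  assumes closed: "\<And>d. d \<in> A \<Longrightarrow> f d \<in> A"
    and range: "\<And>d. d \<in> A \<Longrightarrow> pos d \<in> {0..<L}"
    and step: "\<And>d. d \<in> A \<Longrightarrow> pos (f d) = (pos d + 1) mod L"
    and inj: "inj_on pos A"
    and "d \<in> A"
  shows "{(f ^^ k) d | k. True} = A"
proof
  show "{(f ^^ k) d | k. True} \<subseteq> A"
    using funpow_cyclic[where A = A and f = f and pos = pos and L = L] assms by blast
  show "A \<subseteq> {(f ^^ k) d | k. True}"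
  proof
    fix d' assume "d' \<in> A"
    have "(f ^^ nat ((pos d' - pos d) mod L)) d = d'"
      by (rule funpow_cyclic_hits[where A = A]) (use assms \<open>d' \<in> A\<close> in auto)
    from this[symmetric] show "d' \<in> {(f ^^ k) d | k. True}" by blast
  qed
qed

text \<open>The powers below the least return time of \<open>e\<close> are distinct, and by
  transitivity they exhaust \<open>A\<close>, so this return time is \<open>card A\<close>. This is
  how a bundle receives a cyclic numbering from a rotation.\<close>

lemma funpow_transitive_enum:
  fixes r :: "'a \<Rightarrow> 'a"
  assumes trans: "\<And>e e'. e \<in> A \<Longrightarrow> e' \<in> A \<Longrightarrow> \<exists>k. (r ^^ k) e = e'"
    and closed: "\<And>e. e \<in> A \<Longrightarrow> r e \<in> A" and e: "e \<in> A"
  shows "inj_on (\<lambda>k. (r ^^ k) e) {..<card A}" "(\<lambda>k. (r ^^ k) e) ` {..<card A} = A"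
    "(r ^^ card A) e = e"
proof -
  define p where "p = (LEAST p. p > 0 \<and> (r ^^ p) e = e)"
  \<comment> \<open>The way back from \<open>r e\<close> to \<open>e\<close> supplies a positive
    period, so a least one exists.\<close>
  obtain k where "(r ^^ k) (r e) = e" using trans[OF closed[OF e] e] by blast
  then have "Suc k > 0 \<and> (r ^^ Suc k) e = e" by (simp add: funpow_swap1)
  then have p: "p > 0" "(r ^^ p) e = e" unfolding p_def by (metis (mono_tags, lifting) LeastI)+
  have min: "p \<le> q" if "q > 0" "(r ^^ q) e = e" for q
    unfolding p_def by (rule Least_le) (use that in simp)
  have inj: "inj_on (\<lambda>k. (r ^^ k) e) {..<p}"
  proof (rule linorder_inj_onI')
    fix a b assume ab: "a \<in> {..<p}" "b \<in> {..<p}" "a < b"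
    show "(r ^^ a) e \<noteq> (r ^^ b) e"
    proof
      assume "(r ^^ a) e = (r ^^ b) e"
      then have "(r ^^ (p - b)) ((r ^^ a) e) = (r ^^ (p - b)) ((r ^^ b) e)" by simp
      then have "(r ^^ (p - b + a)) e = (r ^^ (p - b + b)) e" by (simp only: funpow_add comp_apply)
      then have "(r ^^ (p - b + a)) e = e" using ab p by simp
      then show False using min[of "p - b + a"] ab by simp
    qed
  qed
  have "(r ^^ k) e \<in> A" for k by (induction k) (use e closed in auto)
  moreover have "e' \<in> (\<lambda>k. (r ^^ k) e) ` {..<p}" if e': "e' \<in> A" for e'
  proof -
    obtain k where "(r ^^ k) e = e'" using trans[OF e e'] by blast
    then have "(r ^^ (k mod p)) e = e'" using funpow_mod_eq[OF p(2)] by simp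
    then show ?thesis using p(1) by (metis imageI lessThan_iff mod_less_divisor)
  qed
  ultimately have im: "(\<lambda>k. (r ^^ k) e) ` {..<p} = A" by blast
  then have "card A = p" using card_image[OF inj] by simp
  then show "inj_on (\<lambda>k. (r ^^ k) e) {..<card A}" "(\<lambda>k. (r ^^ k) e) ` {..<card A} = A"
    "(r ^^ card A) e = e" using inj im p by simp_all
qed

lemma card_two_orbits:
  assumes "\<And>d. d \<in> A \<Longrightarrow> orb d = A" "\<And>d. d \<in> B \<Longrightarrow> orb d = B" "A \<noteq> {}" "B \<noteq> {}" "A \<inter> B = {}"
  shows "card (orb ` (A \<union> B)) = 2"
proof -
  have "orb ` A = (\<lambda>_. A) ` A" by (intro image_cong refl assms(1))
  then have A: "orb ` A = {A}" using assms(3) by (simp only: image_constant_conv if_False)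
  have "orb ` B = (\<lambda>_. B) ` B" by (intro image_cong refl assms(2))
  then have B: "orb ` B = {B}" using assms(4) by (simp only: image_constant_conv if_False)
  have "A \<noteq> B" using assms(3,5) by blast
  then have "card {A, B} = 2" by (rule card_2_iff[THEN iffD2, OF exI, OF exI, OF conjI, OF refl])
  then show ?thesis unfolding image_Un A B insert_is_Un[of A "{B}", symmetric] .
qed

lemma mod_succ: "k \<in> {0..<p} \<Longrightarrow> (k + 1) mod p = (if k = p - 1 then 0 else k + 1)" for k p :: int
  by auto

lemma mod_diff_if:
  fixes a b p :: int
  assumes "a \<in> {0..<p}" "b \<in> {0..<p}"
  shows "(a - b) mod p = (if b \<le> a then a - b else a - b + p)"
proof (cases "b \<le> a")
  case False
  then have "(a - b + p) mod p = a - b + p" using assms by (intro mod_pos_pos_trivial) auto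
  then show ?thesis using False by simp
qed (use assms in auto)

text \<open>The disjuncts are the three cyclic rotations of the chain \<open>p\<close>,
  \<open>a\<close>, \<open>b\<close> of inequalities: reading the cycle from \<open>p\<close>
  onwards, one meets \<open>a\<close> before \<open>b\<close>. Without \<open>mod\<close>, such
  comparisons become linear arithmetic.\<close>

definition cyclic_less :: "int \<Rightarrow> int \<Rightarrow> int \<Rightarrow> bool" where
  "cyclic_less p a b \<longleftrightarrow> p \<le> a \<and> a < b \<or> a < b \<and> b < p \<or> b < p \<and> p \<le> a"

lemma mod_diff_less_iff:
  fixes a b p N :: int
  assumes "a \<in> {0..<N}" "b \<in> {0..<N}" "p \<in> {0..<N}"
  shows "(a - p) mod N < (b - p) mod N \<longleftrightarrow> cyclic_less p a b"
  using assms by (auto simp: mod_diff_if cyclic_less_def)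

lemma mod_2_times_odd_eq_iff:
  fixes k l X :: int
  assumes "odd X"
  shows "k mod (2 * X) = l mod (2 * X) \<longleftrightarrow> k mod 2 = l mod 2 \<and> k mod X = l mod X"
proof -
  have "coprime 2 X" using assms by simp
  then have "2 * X dvd k - l \<longleftrightarrow> 2 dvd k - l \<and> X dvd k - l"
    by (metis divides_mult dvd_mult_left dvd_mult_right)
  then show ?thesis unfolding mod_eq_dvd_iff .
qed

lemma mod_2_odd_solve:
  fixes a b X :: int
  assumes "odd X"
  shows "\<exists>k. k mod 2 = a mod 2 \<and> k mod X = b mod X"
proof -
  \<comment> \<open>The witness is \<open>a * X + b * (X + 1)\<close>: modulo 2 the factors
    \<open>X\<close> and \<open>X + 1\<close> are 1 and 0, modulo \<open>X\<close> they are 0 and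
    1.\<close>
  have "2 dvd a * X + b * (X + 1) - a" using assms by auto
  moreover have "X dvd a * X + b * (X + 1) - b" by (simp add: algebra_simps)
  ultimately show ?thesis unfolding mod_eq_dvd_iff by blast
qed

lemma mod_uminus_eq_iff: "(- a) mod p = (- b) mod p \<longleftrightarrow> a mod p = b mod p" for a b p :: int
proof -
  have "- a - - b = - (a - b)" by simp
  then show ?thesis unfolding mod_eq_dvd_iff by (metis dvd_minus_iff)
qed

text \<open>A sign is its own inverse and does not affect divisibility, and the offset
  \<open>p\<close> cancels. This solves the Bernardi equation for the index of the new tree.\<close>

lemma mod_sign_eq_iff:
  fixes \<sigma> :: int
  assumes "\<sigma> \<in> {1, -1}"
  shows "(\<sigma> * i' + p) mod q = (\<sigma> * i + p + a) mod q \<longleftrightarrow> i' mod q = (i + \<sigma> * a) mod q"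
proof -
  have "\<sigma> * i' + p - (\<sigma> * i + p + a) = \<sigma> * (i' - (i + \<sigma> * a))"
    using assms by (auto simp: algebra_simps)
  moreover have "q dvd \<sigma> * t \<longleftrightarrow> q dvd t" for t using assms by auto
  ultimately show ?thesis unfolding mod_eq_dvd_iff by simp
qed

section \<open>General facts on ribbon graphs\<close>

lemma reach_edge:
  assumes "e \<in> F'" "endpts G e = {a, b}"
  shows "reach G F' a b"
proof -
  have "(a, b) \<in> adjrel G F' \<or> a = b"
    using assms unfolding adjrel_def endpts_def
    by (cases "ends G e") (auto simp: doubleton_eq_iff)
  then show ?thesis unfolding reach_def by blast
qed

lemma reach_trans: "reach G F' a b \<Longrightarrow> reach G F' b d \<Longrightarrow> reach G F' a d"
  unfolding reach_def by (rule rtrancl_trans)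

lemma ribbon_rot_trans:
  assumes "ribbon G" "y \<in> verts G"
  shows "e \<in> inc G y \<Longrightarrow> rot G y e \<in> inc G y"
    and "e \<in> inc G y \<Longrightarrow> e' \<in> inc G y \<Longrightarrow> \<exists>k. (rot G y ^^ k) e = e'"
  using assms unfolding ribbon_def bij_betw_def by blast+

lemma rot_fixpoint_imp_eq:
  assumes "ribbon G" "y \<in> verts G" "e \<in> inc G y" "e' \<in> inc G y" "rot G y e = e"
  shows "e' = e"
proof -
  obtain k where "(rot G y ^^ k) e = e'" using ribbon_rot_trans(2)[OF assms(1-4)] by blast
  moreover have "(rot G y ^^ k) e = e" by (induction k) (simp_all add: assms(5))
  ultimately show ?thesis by simp
qed

lemma rot_pair:
  assumes "ribbon G" "y \<in> verts G" "inc G y = {a, b}" "a \<noteq> b"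
  shows "rot G y a = b"
  using ribbon_rot_trans(1)[OF assms(1,2), of a] rot_fixpoint_imp_eq[OF assms(1,2), of a b] assms(3,4)
  by auto

text \<open>If the tour is a single cycle with known positions, then "not yet visited" compares two
  positions relative to the start. Instead of times of the tour one may count the non-tree edges at
  \<open>y\<close> whose half-edge at \<open>y\<close> comes before the opposite one.\<close>

lemma bdiv_eq_card:
  fixes pos :: "'e \<times> 'v \<Rightarrow> int" and G :: "('v, 'e) rgraph"
  assumes loopless: "\<And>e. e \<in> edges G \<Longrightarrow> fst (ends G e) \<noteq> snd (ends G e)"
    and closed: "\<And>d. d \<in> darts G \<Longrightarrow> bstep G T d \<in> darts G"
    and range: "\<And>d. d \<in> darts G \<Longrightarrow> pos d \<in> {0..<L}"
    and step: "\<And>d. d \<in> darts G \<Longrightarrow> pos (bstep G T d) = (pos d + 1) mod L"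
    and inj: "inj_on pos (darts G)"
    and start: "(e0, u) \<in> darts G"
  shows "bdiv G T u e0 y = int (card {e \<in> inc G y. e \<notin> T \<and>
           (pos (e, y) - pos (e0, u)) mod L < (pos (e, oth G e y) - pos (e0, u)) mod L})"
proof -
  define p where "p = bpath G T u e0"
  define rel where "rel d = (pos d - pos (e0, u)) mod L" for d
  have L: "L > 0" using range[OF start] by auto
  have p: "p k \<in> darts G" "pos (p k) = (pos (e0, u) + int k) mod L" for k
    using funpow_cyclic[where A = "darts G" and f = "bstep G T" and pos = pos and L = L
        and d = "(e0, u)" and k = k] assms
    unfolding p_def bpath_def by blast+
  have rel_p: "rel (p k) = int k mod L" for k
    unfolding rel_def p by (simp add: mod_simps)
  have p_rel: "p (nat (rel d)) = d" if "d \<in> darts G" for d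
    unfolding p_def bpath_def rel_def
    by (rule funpow_cyclic_hits[where A = "darts G"]) (use assms that in auto)
  have rel_range: "0 \<le> rel d" "rel d < L" for d
    unfolding rel_def using L by auto
  have p_eq_start: "p k = (e0, u) \<longleftrightarrow> int k mod L = 0" for k
    using p_rel[OF p(1)[of k]] p_rel[OF start] rel_p[of k]
    by (metis bpath_def diff_self funpow_0 mod_0 nat_zero_as_int p_def rel_def)
  have len: "blen G T u e0 = nat L"
    unfolding blen_def
  proof (rule Least_equality)
    show "nat L > 0 \<and> bpath G T u e0 (nat L) = (e0, u)"
      using p_eq_start[of "nat L"] L by (simp add: p_def)
    fix k assume k: "k > 0 \<and> bpath G T u e0 k = (e0, u)"
    then have "int k mod L = 0" using p_eq_start[of k] by (simp add: p_def)
    then have "L dvd int k" by presburger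
    then have "L \<le> int k" using k by (simp add: zdvd_imp_le)
    then show "nat L \<le> k" by simp
  qed
  have oth_dart: "(e, oth G e y) \<in> darts G \<and> oth G e y \<noteq> y" if "(e, y) \<in> darts G" for e y
    using that loopless[of e] unfolding darts_def oth_def endpts_def by auto
  have visited: "(e, oth G e y) \<notin> p ` {..<k} \<longleftrightarrow> rel (e, y) < rel (e, oth G e y)"
    if "p k = (e, y)" "k < nat L" for k e y
  proof -
    have d: "(e, y) \<in> darts G" using p(1)[of k] that by simp
    have rk: "rel (e, y) = int k" using rel_p[of k] that by simp
    have "(e, oth G e y) \<in> p ` {..<k} \<longleftrightarrow> rel (e, oth G e y) < int k"
    proof
      assume "(e, oth G e y) \<in> p ` {..<k}"
      then obtain k' where k': "k' < k" "p k' = (e, oth G e y)" by force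
      have "int k' mod L = int k'" using k' that by simp
      then show "rel (e, oth G e y) < int k"
        using k' rel_p[of k'] by simp
    next
      assume "rel (e, oth G e y) < int k"
      then have "nat (rel (e, oth G e y)) < k"
        using rel_range[of "(e, oth G e y)"] by linarith
      then show "(e, oth G e y) \<in> p ` {..<k}"
        using p_rel[of "(e, oth G e y)"] oth_dart[OF d] by (metis imageI lessThan_iff)
    qed
    \<comment> \<open>A tie would put both half-edges of \<open>e\<close> at the same moment, which
      is impossible without loops; hence the negation of the visit condition is a strict
      inequality.\<close>
    moreover have "rel (e, oth G e y) \<noteq> int k"
    proof
      assume "rel (e, oth G e y) = int k"
      then have "p k = (e, oth G e y)" using p_rel[of "(e, oth G e y)"] oth_dart[OF d] by simp
      then show False using that oth_dart[OF d] by simp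
    qed
    ultimately show ?thesis using rk by linarith
  qed
  let ?K = "{k. k < nat L \<and> snd (p k) = y \<and> fst (p k) \<notin> T
        \<and> (fst (p k), oth G (fst (p k)) y) \<notin> p ` {..<k}}"
  let ?E = "{e \<in> inc G y. e \<notin> T \<and> rel (e, y) < rel (e, oth G e y)}"
  \<comment> \<open>Each half-edge occurs once in a tour, so a chip-dropping time at
    \<open>y\<close> and its edge determine each other.\<close>
  have "bij_betw (\<lambda>k. fst (p k)) ?K ?E"
    unfolding bij_betw_def
  proof
    show "inj_on (\<lambda>k. fst (p k)) ?K"
    proof (rule inj_onI)
      fix k k' assume k: "k \<in> ?K" "k' \<in> ?K" and eq: "fst (p k) = fst (p k')"
      then have "p k = p k'" by (auto intro: prod_eqI)
      then have "int k mod L = int k' mod L" using rel_p by metis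
      moreover have "int k < L" "int k' < L" using k by auto
      ultimately show "k = k'" by simp
    qed
    show "(\<lambda>k. fst (p k)) ` ?K = ?E"
    proof
      show "(\<lambda>k. fst (p k)) ` ?K \<subseteq> ?E"
      proof
        fix e assume "e \<in> (\<lambda>k. fst (p k)) ` ?K"
        then obtain k where k: "k \<in> ?K" "e = fst (p k)" by blast
        then have pk: "p k = (e, y)" by (auto intro: prod_eqI)
        moreover have "e \<in> inc G y" using p(1)[of k] pk unfolding inc_def darts_def by simp
        ultimately show "e \<in> ?E" using k visited[of k e y] by auto
      qed
      show "?E \<subseteq> (\<lambda>k. fst (p k)) ` ?K"
      proof
        fix e assume e: "e \<in> ?E"
        then have d: "(e, y) \<in> darts G" unfolding inc_def darts_def by simp
        let ?k = "nat (rel (e, y))"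
        have pk: "p ?k = (e, y)" using p_rel[OF d] .
        have kL: "?k < nat L" using rel_range[of "(e, y)"] by linarith
        have "?k \<in> ?K" using e pk kL visited[OF pk kL] by simp
        then have "fst (p ?k) \<in> (\<lambda>k. fst (p k)) ` ?K" by (rule imageI)
        then show "e \<in> (\<lambda>k. fst (p k)) ` ?K" using pk by simp
      qed
    qed
  qed
  then have "card ?K = card ?E" by (rule bij_betw_same_card)
  then show ?thesis unfolding bdiv_def len p_def[symmetric] rel_def by simp
qed

section \<open>Chains of two bundles of parallel edges\<close>

locale banana_chain =
  fixes G :: "('v, 'e) rgraph" and v z w :: 'v and m n :: int and C F :: "int \<Rightarrow> 'e"
  assumes m_pos: "0 < m" and n_pos: "0 < n"
    and distinct_verts: "v \<noteq> z" "z \<noteq> w" "v \<noteq> w"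
    and verts_eq: "verts G = {v, z, w}"
    and edges_eq: "edges G = C ` {0..<m} \<union> F ` {0..<n}"
    and disjoint: "C ` {0..<m} \<inter> F ` {0..<n} = {}"
    and inj_C: "inj_on C {0..<m}" and inj_F: "inj_on F {0..<n}"
    and endpts_C: "k \<in> {0..<m} \<Longrightarrow> endpts G (C k) = {v, z}"
    and endpts_F: "l \<in> {0..<n} \<Longrightarrow> endpts G (F l) = {z, w}"
    and rot_v: "k \<in> {0..<m} \<Longrightarrow> rot G v (C k) = C ((k + 1) mod m)"
    and rot_w: "l \<in> {0..<n} \<Longrightarrow> rot G w (F l) = F ((l + 1) mod n)"
    and rot_z_C: "k \<in> {0..<m} \<Longrightarrow> rot G z (C k) = (if k = m - 1 then F 0 else C (k + 1))"
    and rot_z_F: "l \<in> {0..<n} \<Longrightarrow> rot G z (F l) = (if l = n - 1 then C 0 else F (l + 1))"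
begin

text \<open>Reversing the chain exchanges the bundles. The rotation at \<open>z\<close> is cyclic
  and may equally be read as \<open>F\<close> followed by \<open>C\<close>, so each fact about
  \<open>v\<close> and \<open>C\<close> also gives the fact about \<open>w\<close> and
  \<open>F\<close>.\<close>

lemma swapped: "banana_chain G w z v n m F C"
  using m_pos n_pos distinct_verts verts_eq edges_eq disjoint inj_C inj_F endpts_C endpts_F
    rot_v rot_w rot_z_C rot_z_F
  by unfold_locales (auto simp: insert_commute)

text \<open>With indices reduced, arbitrary integers name a tree, and torsor actions can be stated
  as translations without range conditions.\<close>

definition tr :: "int \<Rightarrow> int \<Rightarrow> 'e set" where
  "tr a b = {C (a mod m), F (b mod n)}"

text \<open>These are coordinates for the cokernel of the Laplacian, which is the integers times the
  cyclic groups of orders \<open>m\<close> and \<open>n\<close>. The count at \<open>z\<close> is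
  fixed by the degree.\<close>

definition cls :: "int \<Rightarrow> int \<Rightarrow> int \<Rightarrow> ('v \<Rightarrow> int) set" where
  "cls d a b = {D. config G D \<and> cdeg G D = d \<and> D v mod m = a mod m \<and> D w mod n = b mod n}"

lemma tr_mod: "tr (a mod m) b = tr a b" "tr a (b mod n) = tr a b"
  by (simp_all add: tr_def)

lemma mod_m: "a mod m \<in> {0..<m}" and mod_n: "b mod n \<in> {0..<n}"
  using m_pos n_pos by auto

lemma C_eq_iff: "k \<in> {0..<m} \<Longrightarrow> k' \<in> {0..<m} \<Longrightarrow> C k = C k' \<longleftrightarrow> k = k'"
  using inj_C by (auto dest: inj_onD)

lemma F_eq_iff: "l \<in> {0..<n} \<Longrightarrow> l' \<in> {0..<n} \<Longrightarrow> F l = F l' \<longleftrightarrow> l = l'"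
  using inj_F by (auto dest: inj_onD)

lemma C_neq_F: "k \<in> {0..<m} \<Longrightarrow> l \<in> {0..<n} \<Longrightarrow> C k \<noteq> F l"
  using disjoint by (metis IntI empty_iff imageI)

lemma tr_eq_iff: "tr a b = tr a' b' \<longleftrightarrow> a mod m = a' mod m \<and> b mod n = b' mod n"
  unfolding tr_def doubleton_eq_iff
  using C_eq_iff[OF mod_m mod_m] F_eq_iff[OF mod_n mod_n] C_neq_F[OF mod_m mod_n] by metis

lemma ends_C: "k \<in> {0..<m} \<Longrightarrow> ends G (C k) = (v, z) \<or> ends G (C k) = (z, v)"
  using endpts_C[of k] distinct_verts unfolding endpts_def
  by (cases "ends G (C k)") (auto simp: doubleton_eq_iff)

lemma ends_F: "l \<in> {0..<n} \<Longrightarrow> ends G (F l) = (z, w) \<or> ends G (F l) = (w, z)"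
  using endpts_F[of l] distinct_verts unfolding endpts_def
  by (cases "ends G (F l)") (auto simp: doubleton_eq_iff)

lemma oth_C: "k \<in> {0..<m} \<Longrightarrow> oth G (C k) v = z" "k \<in> {0..<m} \<Longrightarrow> oth G (C k) z = v"
  using ends_C[of k] distinct_verts unfolding oth_def by (metis fst_conv snd_conv)+

lemma oth_F: "l \<in> {0..<n} \<Longrightarrow> oth G (F l) z = w" "l \<in> {0..<n} \<Longrightarrow> oth G (F l) w = z"
  using ends_F[of l] distinct_verts unfolding oth_def by (metis fst_conv snd_conv)+

lemma inc_v: "inc G v = C ` {0..<m}"
  using edges_eq endpts_C endpts_F distinct_verts unfolding inc_def by auto

lemma inc_w: "inc G w = F ` {0..<n}"
  using edges_eq endpts_C endpts_F distinct_verts unfolding inc_def by auto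

lemma inc_z: "inc G z = C ` {0..<m} \<union> F ` {0..<n}"
  using edges_eq endpts_C endpts_F distinct_verts unfolding inc_def by auto

lemma darts_eq: "darts G = (\<lambda>k. (C k, v)) ` {0..<m} \<union> (\<lambda>k. (C k, z)) ` {0..<m}
    \<union> (\<lambda>l. (F l, z)) ` {0..<n} \<union> (\<lambda>l. (F l, w)) ` {0..<n}"
  using edges_eq endpts_C endpts_F unfolding darts_def by auto

lemma dart_cases:
  assumes "d \<in> darts G"
  obtains (Cv) k where "k \<in> {0..<m}" "d = (C k, v)" | (Cz) k where "k \<in> {0..<m}" "d = (C k, z)"
    | (Fz) l where "l \<in> {0..<n}" "d = (F l, z)" | (Fw) l where "l \<in> {0..<n}" "d = (F l, w)"
  using assms unfolding darts_eq by auto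

section \<open>Laplacian, divisor classes and Picard group\<close>

lemma lap_v: "lap G f v = m * (f v - f z)"
proof -
  have "lap G f v = (\<Sum>e\<in>C ` {0..<m}. f v - f z)"
    unfolding lap_def inc_v by (rule sum.cong) (auto simp: oth_C)
  then show ?thesis using m_pos by (simp add: card_image[OF inj_C])
qed

lemma lap_w: "lap G f w = n * (f w - f z)"
  using banana_chain.lap_v[OF swapped] .

lemma lap_z: "lap G f z = m * (f z - f v) + n * (f z - f w)"
proof -
  have "lap G f z = (\<Sum>e\<in>C ` {0..<m}. f z - f (oth G e z)) + (\<Sum>e\<in>F ` {0..<n}. f z - f (oth G e z))"
    unfolding lap_def inc_z by (rule sum.union_disjoint) (use disjoint in auto)
  also have "(\<Sum>e\<in>C ` {0..<m}. f z - f (oth G e z)) = (\<Sum>e\<in>C ` {0..<m}. f z - f v)"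
    by (rule sum.cong) (auto simp: oth_C)
  also have "(\<Sum>e\<in>F ` {0..<n}. f z - f (oth G e z)) = (\<Sum>e\<in>F ` {0..<n}. f z - f w)"
    by (rule sum.cong) (auto simp: oth_F)
  finally show ?thesis using m_pos n_pos by (simp add: card_image[OF inj_C] card_image[OF inj_F])
qed

lemma cdeg_eq: "cdeg G D = D v + D z + D w"
  unfolding cdeg_def verts_eq using distinct_verts by simp

text \<open>A firing vector acts only through \<open>f v - f z\<close> and \<open>f w - f z\<close>,
  which are arbitrary integers and change the counts at \<open>v\<close> and \<open>w\<close> by
  multiples of \<open>m\<close> and \<open>n\<close>. Preservation of the degree then takes care of
  \<open>z\<close>.\<close>

lemma linequiv_iff:
  "linequiv G D D' \<longleftrightarrow> cdeg G D' = cdeg G D \<and> D' v mod m = D v mod m \<and> D' w mod n = D w mod n"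
proof
  assume "linequiv G D D'"
  then obtain f where "\<forall>x\<in>verts G. D' x = D x - lap G f x" unfolding linequiv_def by blast
  then have *: "D' v = D v - m * (f v - f z)" "D' w = D w - n * (f w - f z)"
      "D' z = D z - (m * (f z - f v) + n * (f z - f w))"
    unfolding verts_eq by (auto simp only: ball_simps insert_iff lap_v lap_w lap_z)
  show "cdeg G D' = cdeg G D \<and> D' v mod m = D v mod m \<and> D' w mod n = D w mod n"
    unfolding cdeg_eq * mod_eq_dvd_iff by (simp add: algebra_simps)
next
  assume *: "cdeg G D' = cdeg G D \<and> D' v mod m = D v mod m \<and> D' w mod n = D w mod n"
  then obtain a b where ab: "D v - D' v = m * a" "D w - D' w = n * b"
    by (metis dvd_def mod_eq_dvd_iff)
  \<comment> \<open>Normalising \<open>f z = 0\<close> makes the firing numbers of the ends equal to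
    the two quotients.\<close>
  define f where "f = (\<lambda>y. if y = v then a else if y = w then b else 0)"
  have f: "f v = a" "f w = b" "f z = 0" unfolding f_def using distinct_verts by auto
  have "D' v = D v - lap G f v" "D' w = D w - lap G f w" "D' z = D z - lap G f z"
    using ab * unfolding lap_v lap_w lap_z f cdeg_eq by simp_all
  then have "\<forall>x\<in>verts G. D' x = D x - lap G f x"
    unfolding verts_eq by blast
  then show "linequiv G D D'" unfolding linequiv_def by blast
qed

lemma pcls_eq: "pcls G D = cls (cdeg G D) (D v) (D w)"
  unfolding pcls_def cls_def linequiv_iff by auto

lemma cls_cong: "a mod m = a' mod m \<Longrightarrow> b mod n = b' mod n \<Longrightarrow> cls d a b = cls d a' b'"
  unfolding cls_def by simp

definition divisor :: "int \<Rightarrow> int \<Rightarrow> int \<Rightarrow> 'v \<Rightarrow> int" where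
  "divisor d a b = (\<lambda>y. if y = v then a else if y = w then b else if y = z then d - a - b else 0)"

lemma divisor_simps [simp]:
  "divisor d a b v = a" "divisor d a b w = b" "divisor d a b z = d - a - b"
  "config G (divisor d a b)" "cdeg G (divisor d a b) = d"
  unfolding cdeg_eq using distinct_verts by (auto simp: divisor_def config_def verts_eq)

lemma divisor_in_cls: "a mod m = a' mod m \<Longrightarrow> b mod n = b' mod n \<Longrightarrow> divisor d a b \<in> cls d a' b'"
  by (simp add: cls_def)

lemma cls_eq_iff: "cls d a b = cls d a' b' \<longleftrightarrow> a mod m = a' mod m \<and> b mod n = b' mod n"
proof
  assume "cls d a b = cls d a' b'"
  moreover have "divisor d a b \<in> cls d a b" by (rule divisor_in_cls) auto
  ultimately have "divisor d a b \<in> cls d a' b'" by simp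
  then show "a mod m = a' mod m \<and> b mod n = b' mod n" by (simp add: cls_def)
qed (rule cls_cong; simp)

lemma Pic_eq: "Pic G d = {cls d a b | a b. True}"
proof
  show "Pic G d \<subseteq> {cls d a b | a b. True}"
    unfolding Pic_def pcls_eq by auto
  show "{cls d a b | a b. True} \<subseteq> Pic G d"
  proof
    fix S assume "S \<in> {cls d a b | a b. True}"
    then obtain a b where "S = cls d a b" by blast
    then have "S = pcls G (divisor d a b)" by (simp add: pcls_eq)
    then show "S \<in> Pic G d" unfolding Pic_def by simp
  qed
qed

lemma pic_add_cls: "pic_add (cls d a b) (cls d' a' b') = cls (d + d') (a + a') (b + b')"
proof
  show "pic_add (cls d a b) (cls d' a' b') \<subseteq> cls (d + d') (a + a') (b + b')"
    unfolding pic_add_def cls_def config_def cdeg_eq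
    by (auto intro: mod_add_cong)
  show "cls (d + d') (a + a') (b + b') \<subseteq> pic_add (cls d a b) (cls d' a' b')"
  proof
    fix D assume D: "D \<in> cls (d + d') (a + a') (b + b')"
    \<comment> \<open>Subtracting one fixed member of the second class leaves a member of the first,
      so the elementwise sum is the whole class.\<close>
    let ?E = "\<lambda>y. D y - divisor d' a' b' y"
    have "?E v mod m = (a + a' - a') mod m" "?E w mod n = (b + b' - b') mod n"
      using D unfolding cls_def divisor_simps mem_Collect_eq by (blast intro: mod_diff_cong)+
    moreover have "config G ?E"
      using D divisor_simps(4)[of d' a' b'] unfolding cls_def config_def by auto
    moreover have "cdeg G ?E = d"
      using D unfolding cls_def by (simp add: cdeg_eq)
    ultimately have "?E \<in> cls d a b" unfolding cls_def by simp
    moreover have "divisor d' a' b' \<in> cls d' a' b'" by (rule divisor_in_cls) auto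
    ultimately show "D \<in> pic_add (cls d a b) (cls d' a' b')"
      unfolding pic_add_def by force
  qed
qed

section \<open>Spanning trees\<close>

lemma reach_C:
  assumes "F' \<subseteq> C ` {0..<m}" "reach G F' a b"
  shows "a = b \<or> {a, b} = {v, z}"
proof -
  have "adjrel G F' \<subseteq> {(v, z), (z, v)}"
    using assms(1) ends_C unfolding adjrel_def by fastforce
  moreover have "(a, b) \<in> {(v, z), (z, v)}\<^sup>* \<Longrightarrow> a = b \<or> {a, b} = {v, z}"
    by (induction rule: rtrancl_induct) auto
  ultimately show ?thesis using assms(2) rtrancl_mono unfolding reach_def by blast
qed

lemma reach_F:
  assumes "F' \<subseteq> F ` {0..<n}" "reach G F' a b"
  shows "a = b \<or> {a, b} = {z, w}"
  using banana_chain.reach_C[OF swapped assms] by blast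

lemma tr_in_sptrees: "tr a b \<in> sptrees G"
proof -
  let ?c = "C (a mod m)" and ?f = "F (b mod n)"
  have e: "endpts G ?c = {v, z}" "endpts G ?f = {z, w}"
    using endpts_C[OF mod_m] endpts_F[OF mod_n] .
  have e': "endpts G ?c = {z, v}" "endpts G ?f = {w, z}" using e by auto
  have in_tr: "?c \<in> tr a b" "?f \<in> tr a b" by (auto simp: tr_def)
  have r: "reach G (tr a b) v z" "reach G (tr a b) z v" "reach G (tr a b) z w" "reach G (tr a b) w z"
    using reach_edge[OF in_tr(1) e(1)] reach_edge[OF in_tr(1) e'(1)]
      reach_edge[OF in_tr(2) e(2)] reach_edge[OF in_tr(2) e'(2)] .
  have "reach G (tr a b) y y" for y unfolding reach_def by simp
  then have "\<forall>y\<in>verts G. \<forall>y'\<in>verts G. reach G (tr a b) y y'"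
    unfolding verts_eq using r reach_trans[of G "tr a b"] by blast
  moreover have "tr a b \<subseteq> edges G" unfolding tr_def edges_eq using mod_m mod_n by auto
  moreover have "card (tr a b) = card (verts G) - 1"
    unfolding tr_def verts_eq using C_neq_F[OF mod_m mod_n] distinct_verts by simp
  ultimately show ?thesis unfolding sptrees_def by blast
qed

text \<open>A tree has two edges, and a single bundle cannot connect \<open>v\<close> to
  \<open>w\<close>; so there is exactly one edge from each bundle.\<close>

lemma sptrees_eq: "sptrees G = {tr a b | a b. True}"
proof
  show "sptrees G \<subseteq> {tr a b | a b. True}"
  proof
    fix T assume "T \<in> sptrees G"
    then have T: "T \<subseteq> edges G" "card T = 2" "reach G T v w"
      unfolding sptrees_def verts_eq using distinct_verts by auto
    have "\<not> T \<subseteq> C ` {0..<m}" "\<not> T \<subseteq> F ` {0..<n}"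
      using reach_C[of T v w] reach_F[of T v w] T(3) distinct_verts
      by (auto simp: doubleton_eq_iff)
    then obtain k l where kl: "k \<in> {0..<m}" "C k \<in> T" "l \<in> {0..<n}" "F l \<in> T"
      using T(1) unfolding edges_eq by blast
    have "T = {C k, F l}"
    proof (rule sym, rule card_subset_eq)
      show "finite T" using T(2) card.infinite by force
      show "card {C k, F l} = card T" using C_neq_F[of k l] kl T(2) by simp
    qed (use kl in auto)
    then have "T = tr k l" unfolding tr_def using kl by simp
    then show "T \<in> {tr a b | a b. True}" by blast
  qed
  show "{tr a b | a b. True} \<subseteq> sptrees G" using tr_in_sptrees by blast
qed

section \<open>Divisors supported on the two ends of the chain\<close>

lemma supported_on_divisor: "supported_on {v, w} (divisor 0 k (- k))"
  unfolding supported_on_def divisor_def by simp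

lemma supported_on_in_cls:
  assumes "supported_on {v, w} D" "D \<in> cls 0 a b"
  shows "D v mod m = a mod m" "D w = - D v" "D w mod n = b mod n"
proof -
  have "D z = 0" using assms(1) distinct_verts unfolding supported_on_def by simp
  then show "D v mod m = a mod m" "D w = - D v" "D w mod n = b mod n"
    using assms(2) unfolding cls_def cdeg_eq by auto
qed

text \<open>Such divisors are the multiples of \<open>v - w\<close>, so one integer is compared
  modulo both \<open>m\<close> and \<open>n\<close>. For the two graphs of the theorem this is in
  either case a comparison modulo \<open>2 x\<close>.\<close>

lemma linequiv_supported:
  assumes "supported_on {v, w} D1" "supported_on {v, w} D2" "sum D1 {v, w} = 0" "sum D2 {v, w} = 0"
  shows "linequiv G D1 D2 \<longleftrightarrow> D2 v mod m = D1 v mod m \<and> D2 v mod n = D1 v mod n"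
proof -
  have "D1 w = - D1 v" "D2 w = - D2 v" "D1 z = 0" "D2 z = 0"
    using assms distinct_verts unfolding supported_on_def by auto
  then show ?thesis unfolding linequiv_iff cdeg_eq by (simp add: mod_uminus_eq_iff)
qed

section \<open>Rotor routing\<close>

definition idx_C :: "'e \<Rightarrow> int" where "idx_C = the_inv_into {0..<m} C"
definition idx_F :: "'e \<Rightarrow> int" where "idx_F = the_inv_into {0..<n} F"

lemma idx_C [simp]: "k \<in> {0..<m} \<Longrightarrow> idx_C (C k) = k"
  unfolding idx_C_def using inj_C by (rule the_inv_into_f_f)

lemma idx_F [simp]: "l \<in> {0..<n} \<Longrightarrow> idx_F (F l) = l"
  unfolding idx_F_def using inj_F by (rule the_inv_into_f_f)

lemma C_notin_F: "k \<in> {0..<m} \<Longrightarrow> C k \<notin> F ` {0..<n}"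
  using C_neq_F by blast

text \<open>
  With root \<open>w\<close>, each firing of \<open>v\<close> advances the rotor at \<open>v\<close>, and the chips sent from \<open>z\<close> to
  \<open>v\<close> or \<open>w\<close> are recorded by the position of the rotor at \<open>z\<close>, whence the two conserved residues
  \<open>A\<close> and \<open>B\<close>. The condition \<open>0 < c v + c z\<close> says that a directed cycle of rotors carries a
  chip, so that the final rotors form a tree.
\<close>

definition rinv_w :: "int \<Rightarrow> int \<Rightarrow> ('v \<Rightarrow> int) \<Rightarrow> ('v \<Rightarrow> 'e) \<Rightarrow> bool" where
  "rinv_w A B c r \<longleftrightarrow> 0 \<le> c v \<and> 0 \<le> c z \<and> (\<exists>i\<in>{0..<m}. r v = C i \<and>
     ((\<exists>k\<in>{0..<m}. r z = C k \<and> 0 < c v + c z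
          \<and> (i + c v - (k + 1)) mod m = A mod m \<and> (c v + c z) mod n = B mod n)
    \<or> (\<exists>l\<in>{0..<n}. r z = F l
          \<and> (i + c v) mod m = A mod m \<and> (l + 1 + c v + c z) mod n = B mod n)))"

lemma rinv_w_I_C:
  assumes "0 \<le> c v" "0 \<le> c z" "i \<in> {0..<m}" "r v = C i" "k \<in> {0..<m}" "r z = C k"
    "0 < c v + c z" "(i + c v - (k + 1)) mod m = A mod m" "(c v + c z) mod n = B mod n"
  shows "rinv_w A B c r"
  using assms unfolding rinv_w_def by blast

lemma rinv_w_I_F:
  assumes "0 \<le> c v" "0 \<le> c z" "i \<in> {0..<m}" "r v = C i" "l \<in> {0..<n}" "r z = F l"
    "(i + c v) mod m = A mod m" "(l + 1 + c v + c z) mod n = B mod n"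
  shows "rinv_w A B c r"
  using assms unfolding rinv_w_def by blast

lemma rinv_w_D_F:
  assumes "rinv_w A B c r" "i \<in> {0..<m}" "r v = C i" "l \<in> {0..<n}" "r z = F l"
  shows "(i + c v) mod m = A mod m" "(l + 1 + c v + c z) mod n = B mod n"
proof -
  obtain i' l' where "i' \<in> {0..<m}" "r v = C i'" "l' \<in> {0..<n}" "r z = F l'"
      and eqs: "(i' + c v) mod m = A mod m" "(l' + 1 + c v + c z) mod n = B mod n"
    using assms(1,4,5) C_neq_F unfolding rinv_w_def by metis
  then have "i' = i" "l' = l" using assms C_eq_iff F_eq_iff by metis+
  with eqs show "(i + c v) mod m = A mod m" "(l + 1 + c v + c z) mod n = B mod n" by simp_all
qed

text \<open>The chips away from \<open>w\<close> never increase in number, and decrease whenever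
  \<open>z\<close> fires into \<open>F\<close>. Otherwise the second entry counts the edges of
  \<open>C\<close> still ahead of the rotor at \<open>z\<close> and falls when \<open>z\<close>
  fires into \<open>C\<close>; its value on \<open>F\<close> exceeds all values on \<open>C\<close>.
  Firing \<open>v\<close> leaves these two entries alone and lowers the third.\<close>

definition rmeasure_w :: "('v \<Rightarrow> int) \<Rightarrow> ('v \<Rightarrow> 'e) \<Rightarrow> nat \<times> nat \<times> nat" where
  "rmeasure_w c r = (nat (c v + c z),
     if r z \<in> F ` {0..<n} then nat m else nat (m - 1 - idx_C (r z)), nat (c v))"

lemma rstep_w:
  assumes "rstep G w (c, r) (c', r')" and inv: "rinv_w A B c r"
  shows "rinv_w A B c' r'
    \<and> (rmeasure_w c' r', rmeasure_w c r) \<in> less_than <*lex*> less_than <*lex*> less_than"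
proof -
  obtain i where i: "i \<in> {0..<m}" "r v = C i" using inv unfolding rinv_w_def by blast
  have nonneg: "0 \<le> c v" "0 \<le> c z" using inv unfolding rinv_w_def by blast+
  obtain y where y: "y \<in> {v, z, w}" "y \<noteq> w" "c y > 0"
    and c': "c' = c(y := c y - 1, oth G (rot G y (r y)) y := c (oth G (rot G y (r y)) y) + 1)"
    and r': "r' = r(y := rot G y (r y))"
    using assms(1) unfolding rstep_def verts_eq Let_def by auto
  \<comment> \<open>For a firing of \<open>z\<close> the two letters name the bundles of its rotor
    before and after the move.\<close>
  consider (v) "y = v" | (z_CC) k where "y = z" "k \<in> {0..<m}" "r z = C k" "k \<noteq> m - 1"
    | (z_CF) "y = z" "r z = C (m - 1)"
    | (z_FF) l where "y = z" "l \<in> {0..<n}" "r z = F l" "l \<noteq> n - 1"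
    | (z_FC) "y = z" "r z = F (n - 1)"
    using y inv unfolding rinv_w_def by blast
  then show ?thesis
  proof cases
    case v
    let ?i = "(i + 1) mod m"
    have r'_eq: "r' v = C ?i" "r' z = r z"
      using r' v i rot_v distinct_verts by auto
    have c'_eq: "c' v = c v - 1" "c' z = c z + 1"
      using c' v i rot_v oth_C[OF mod_m] distinct_verts by auto
    have i_mod: "(?i + (c v - 1 - q)) mod m = (i + c v - q) mod m" for q
      using mod_add_left_eq[of "i + 1" m "c v - 1 - q"] by (simp add: add_diff_eq)
    have pos: "0 < c v" using y(3) v by simp
    consider k where "k \<in> {0..<m}" "r z = C k" "(i + c v - (k + 1)) mod m = A mod m"
        "(c v + c z) mod n = B mod n"
      | l where "l \<in> {0..<n}" "r z = F l" "(i + c v) mod m = A mod m"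
        "(l + 1 + c v + c z) mod n = B mod n"
      using inv i unfolding rinv_w_def by (auto simp: C_eq_iff)
    then have "rinv_w A B c' r'"
    proof cases
      case (1 k)
      show ?thesis
        by (rule rinv_w_I_C[of _ ?i _ k])
          (use 1 pos nonneg mod_m i_mod[of "k + 1"] in \<open>simp_all add: r'_eq c'_eq diff_add_eq[symmetric] add_diff_eq\<close>)
    next
      case (2 l)
      show ?thesis
        by (rule rinv_w_I_F[of _ ?i _ l])
          (use 2 pos nonneg mod_m i_mod[of 0] in \<open>simp_all add: r'_eq c'_eq algebra_simps\<close>)
    qed
    moreover have "(rmeasure_w c' r', rmeasure_w c r) \<in> less_than <*lex*> less_than <*lex*> less_than"
      using y(3) v unfolding rmeasure_w_def r'_eq c'_eq by auto
    ultimately show ?thesis by blast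
  next
    case (z_CC k)
    have k1: "k + 1 \<in> {0..<m}" using z_CC by auto
    have r'_eq: "r' v = C i" "r' z = C (k + 1)"
      using r' z_CC i rot_z_C distinct_verts by auto
    have c'_eq: "c' v = c v + 1" "c' z = c z - 1"
      using c' z_CC i rot_z_C oth_C[OF k1] distinct_verts by auto
    have "(i + c v - (k + 1)) mod m = A mod m \<and> (c v + c z) mod n = B mod n"
      using inv i z_CC C_neq_F unfolding rinv_w_def by (auto simp: C_eq_iff)
    then have "rinv_w A B c' r'"
      using i k1 y(3) nonneg z_CC
      by (intro rinv_w_I_C[of _ i _ "k + 1"]) (simp_all add: r'_eq c'_eq algebra_simps)
    moreover have "(rmeasure_w c' r', rmeasure_w c r) \<in> less_than <*lex*> less_than <*lex*> less_than"
      using z_CC k1 C_notin_F[OF k1] C_notin_F[of k] unfolding rmeasure_w_def r'_eq c'_eq by simp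
    ultimately show ?thesis by blast
  next
    case z_CF
    have k: "m - 1 \<in> {0..<m}" and l: "0 \<in> {0..<n}" using m_pos n_pos by auto
    have r'_eq: "r' v = C i" "r' z = F 0"
      using r' z_CF i rot_z_C[OF k] distinct_verts by auto
    have c'_eq: "c' v = c v" "c' z = c z - 1"
      using c' z_CF i rot_z_C[OF k] oth_F[OF l] distinct_verts by auto
    \<comment> \<open>On leaving \<open>C\<close> all \<open>m\<close> of its edges have sent a chip
      to \<open>v\<close>, and a full round is invisible modulo \<open>m\<close>.\<close>
    have "(i + c v - m) mod m = A mod m \<and> (c v + c z) mod n = B mod n"
      using inv i z_CF C_neq_F[OF k] k unfolding rinv_w_def by (auto simp: C_eq_iff)
    then have "rinv_w A B c' r'"
      using i l y(3) nonneg z_CF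
      by (intro rinv_w_I_F[of _ i _ 0]) (simp_all add: r'_eq c'_eq algebra_simps)
    moreover have "(rmeasure_w c' r', rmeasure_w c r) \<in> less_than <*lex*> less_than <*lex*> less_than"
      using z_CF nonneg y(3) unfolding rmeasure_w_def r'_eq c'_eq by auto
    ultimately show ?thesis by blast
  next
    case (z_FF l)
    have l: "l + 1 \<in> {0..<n}" using z_FF by auto
    have r'_eq: "r' v = C i" "r' z = F (l + 1)"
      using r' z_FF i rot_z_F distinct_verts by auto
    have c'_eq: "c' v = c v" "c' z = c z - 1"
      using c' z_FF i rot_z_F oth_F[OF l] distinct_verts by auto
    have "(i + c v) mod m = A mod m \<and> (l + 1 + c v + c z) mod n = B mod n"
      using rinv_w_D_F[OF inv i z_FF(2,3)] by simp
    then have "rinv_w A B c' r'"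
      using i l y(3) nonneg z_FF
      by (intro rinv_w_I_F[of _ i _ "l + 1"]) (simp_all add: r'_eq c'_eq algebra_simps)
    moreover have "(rmeasure_w c' r', rmeasure_w c r) \<in> less_than <*lex*> less_than <*lex*> less_than"
      using z_FF nonneg y(3) unfolding rmeasure_w_def r'_eq c'_eq by auto
    ultimately show ?thesis by blast
  next
    case z_FC
    have l: "n - 1 \<in> {0..<n}" and k: "0 \<in> {0..<m}" using m_pos n_pos by auto
    have r'_eq: "r' v = C i" "r' z = C 0"
      using r' z_FC i rot_z_F[OF l] distinct_verts by auto
    have c'_eq: "c' v = c v + 1" "c' z = c z - 1"
      using c' z_FC i rot_z_F[OF l] oth_C[OF k] distinct_verts by auto
    \<comment> \<open>Likewise a completed round through \<open>F\<close> contributes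
      \<open>n\<close> and drops out. The chip now sent to \<open>v\<close> supplies the positivity
      required while the rotor is in \<open>C\<close>.\<close>
    have "(i + c v) mod m = A mod m \<and> (n + (c v + c z)) mod n = B mod n"
      using rinv_w_D_F[OF inv i l z_FC(2)] by (simp add: add.assoc)
    then have "rinv_w A B c' r'"
      using i k y(3) nonneg z_FC
      by (intro rinv_w_I_C[of _ i _ 0]) (simp_all add: r'_eq c'_eq algebra_simps)
    moreover have "(rmeasure_w c' r', rmeasure_w c r) \<in> less_than <*lex*> less_than <*lex*> less_than"
      using z_FC l k C_notin_F[OF k] m_pos unfolding rmeasure_w_def r'_eq c'_eq by simp
    ultimately show ?thesis by blast
  qed
qed

lemma rsteps_w:
  assumes "(rstep G w)\<^sup>*\<^sup>* s s'" "rinv_w A B (fst s) (snd s)"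
  shows "rinv_w A B (fst s') (snd s')"
  using assms
proof (induction rule: rtranclp_induct)
  case (step s' s'')
  then show ?case using rstep_w[of "fst s'" "snd s'" "fst s''" "snd s''" A B] by simp
qed auto

lemma rstep_exists:
  assumes "y \<in> verts G - {u}" "c y > 0"
  shows "\<exists>c' r'. rstep G u (c, r) (c', r')"
  using assms unfolding rstep_def Let_def by fastforce

lemma rotor_terminates_w:
  assumes "rinv_w A B c r"
  shows "\<exists>c' r'. (rstep G w)\<^sup>*\<^sup>* (c, r) (c', r') \<and> (\<forall>y\<in>verts G - {w}. c' y = 0)"
  using assms
proof (induction "rmeasure_w c r" arbitrary: c r
    rule: wf_induct_rule[OF wf_lex_prod[OF wf_less_than wf_lex_prod[OF wf_less_than wf_less_than]]])
  case 1
  show ?case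
  proof (cases "\<forall>y\<in>verts G - {w}. c y = 0")
    case False
    then have "c v \<noteq> 0 \<or> c z \<noteq> 0" unfolding verts_eq by auto
    then obtain y where "y \<in> verts G - {w}" "c y > 0"
      using 1(2) distinct_verts unfolding rinv_w_def verts_eq
      by (metis (no_types, lifting) Diff_iff empty_iff insert_iff order_le_less)
    then obtain c' r' where s: "rstep G w (c, r) (c', r')" using rstep_exists by blast
    note s' = rstep_w[OF s 1(2)]
    show ?thesis using 1(1)[of c' r'] s' s by (meson converse_rtranclp_into_rtranclp)
  qed blast
qed

lemma torient_w: "torient G (tr a b) w v = C (a mod m)" "torient G (tr a b) w z = F (b mod n)"
proof -
  let ?c = "C (a mod m)" and ?f = "F (b mod n)"
  have cf: "?c \<noteq> ?f" using C_neq_F[OF mod_m mod_n] .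
  have diff: "tr a b - {?c} = {?f}" "tr a b - {?f} = {?c}" unfolding tr_def using cf by auto
  have inc: "?c \<in> inc G v" "?f \<notin> inc G v" "?c \<in> inc G z" "?f \<in> inc G z"
    unfolding inc_v inc_z using imageI[OF mod_m, of C a] imageI[OF mod_n, of F b] disjoint by blast+
  have "{v, w} \<noteq> {z, w}" "{z, w} \<noteq> {v, z}" using distinct_verts by (auto simp: doubleton_eq_iff)
  then have "\<not> reach G {?f} v w" "\<not> reach G {?c} z w"
    using reach_F[of "{?f}" v w] reach_C[of "{?c}" z w] imageI[OF mod_m, of C a]
      imageI[OF mod_n, of F b] distinct_verts by blast+
  moreover have "reach G {?f} z w" using reach_edge[of ?f "{?f}" G z w] endpts_F[OF mod_n] by simp
  moreover have "e \<in> tr a b \<longleftrightarrow> e = ?c \<or> e = ?f" for e by (simp add: tr_def)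
  ultimately show "torient G (tr a b) w v = ?c" "torient G (tr a b) w z = ?f"
    unfolding torient_def using inc diff by (metis (mono_tags, lifting) the_equality)+
qed

lemma cls_nonneg_w: "\<exists>D\<in>cls 0 a b. 0 \<le> D v \<and> 0 \<le> D z"
proof
  \<comment> \<open>A multiple of \<open>n\<close> is borrowed from the root;
    \<open>n * (m + 1)\<close> is at least \<open>m + n\<close>, enough to cover the chips needed at
    \<open>z\<close>.\<close>
  let ?D = "divisor 0 (a mod m) (b mod n - n * (m + 1))"
  show "?D \<in> cls 0 a b" by (rule divisor_in_cls) (simp_all add: mod_diff_eq[symmetric])
  have "m \<le> n * m" using m_pos n_pos by simp
  moreover have "a mod m < m" "b mod n < n" "0 \<le> a mod m" using m_pos n_pos by simp_all
  moreover have "?D z = n * m + n - a mod m - b mod n" by (simp add: algebra_simps)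
  ultimately show "0 \<le> ?D v \<and> 0 \<le> ?D z" unfolding divisor_simps(1) by linarith
qed

text \<open>The conserved residues are read off at the start and at the end. They hold along every
  run from every admissible representative, so the outcome depends on neither choice and the
  \<open>SOME\<close> in \<open>rotor\<close> has only one candidate.\<close>

lemma rotor_w: "rotor G w (cls 0 a b) (tr i j) = tr (i + a) (j - b)"
proof -
  let ?r = "torient G (tr i j) w"
  have init: "rinv_w (i + a) (j + 1 - b) D ?r"
    if "D \<in> cls 0 a b" "0 \<le> D v" "0 \<le> D z" for D
  proof -
    have D: "D v mod m = a mod m" "D w mod n = b mod n" "D v + D z + D w = 0"
      using that(1) unfolding cls_def cdeg_eq by simp_all
    \<comment> \<open>The sign of the second coordinate arises here: the chips to be routed into the
      root \<open>w\<close> number \<open>- D w\<close>.\<close>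
    have deg: "D v + D z = - D w" using D(3) by linarith
    have eq_v: "(i mod m + D v) mod m = (i + a) mod m"
      by (rule mod_add_cong) (simp_all only: D(1) mod_mod_trivial)
    have eq_w: "(j mod n + 1 + (D v + D z)) mod n = (j + 1 - b) mod n"
      unfolding deg add_uminus_conv_diff
      by (rule mod_diff_cong) (simp_all only: D(2) mod_add_left_eq)
    show ?thesis
      using eq_v eq_w[folded add.assoc]
      by (rule rinv_w_I_F[OF that(2,3) mod_m torient_w(1) mod_n torient_w(2)])
  qed
  have final: "r ` (verts G - {w}) = tr (i + a) (j - b)"
    if inv: "rinv_w (i + a) (j + 1 - b) c r" and "\<forall>y\<in>verts G - {w}. c y = 0" for c r
  proof -
    have c: "c v = 0" "c z = 0" using that(2) distinct_verts unfolding verts_eq by auto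
    \<comment> \<open>Without chips away from \<open>w\<close> the alternative with the rotor of
      \<open>z\<close> in \<open>C\<close> violates its positivity condition, so the rotor lies in
      \<open>F\<close>.\<close>
    obtain k l where kl: "k \<in> {0..<m}" "r v = C k" "k mod m = (i + a) mod m"
        "l \<in> {0..<n}" "r z = F l" "(l + 1) mod n = (j + 1 - b) mod n"
      using inv unfolding rinv_w_def c by (auto simp del: mod_pos_pos_trivial)
    have "(l + 1 - 1) mod n = (j + 1 - b - 1) mod n" using kl(6) by (rule mod_diff_cong) simp
    then have "l mod n = (j - b) mod n" by (simp add: algebra_simps)
    moreover have "r ` (verts G - {w}) = {r v, r z}"
      unfolding verts_eq using distinct_verts by auto
    ultimately show ?thesis using kl unfolding tr_def by simp
  qed
  have uniq: "T' = tr (i + a) (j - b)" if "rotor_rel G w (cls 0 a b) (tr i j) T'" for T'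
  proof -
    obtain D c r where D: "D \<in> cls 0 a b" "\<forall>y\<in>verts G - {w}. 0 \<le> D y"
        and s: "(rstep G w)\<^sup>*\<^sup>* (D, ?r) (c, r)" "\<forall>y\<in>verts G - {w}. c y = 0"
        and T': "T' = r ` (verts G - {w})"
      using \<open>rotor_rel G w (cls 0 a b) (tr i j) T'\<close> unfolding rotor_rel_def by blast
    have "rinv_w (i + a) (j + 1 - b) D ?r"
      using init D distinct_verts unfolding verts_eq by auto
    then show ?thesis using rsteps_w[OF s(1)] final[of c r] s(2) T' by simp
  qed
  obtain D where D: "D \<in> cls 0 a b" "0 \<le> D v" "0 \<le> D z" using cls_nonneg_w by blast
  obtain c r where s: "(rstep G w)\<^sup>*\<^sup>* (D, ?r) (c, r)" "\<forall>y\<in>verts G - {w}. c y = 0"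
    using rotor_terminates_w[OF init[OF D]] by blast
  have "\<forall>y\<in>verts G - {w}. 0 \<le> D y" using D unfolding verts_eq by auto
  then have "rotor_rel G w (cls 0 a b) (tr i j) (r ` (verts G - {w}))"
    using D s unfolding rotor_rel_def by blast
  then show ?thesis unfolding rotor_def using uniq by (metis someI)
qed

lemma swap_tr: "banana_chain.tr n m F C b a = tr a b"
  unfolding tr_def banana_chain.tr_def[OF swapped] by blast

lemma swap_cls: "banana_chain.cls G w v n m d b a = cls d a b"
  unfolding cls_def banana_chain.cls_def[OF swapped] by blast

lemma rotor_v: "rotor G v (cls 0 a b) (tr i j) = tr (i - a) (j + b)"
  using banana_chain.rotor_w[OF swapped, of b a j i] unfolding swap_tr swap_cls .

section \<open>Rotor routing with root \<open>z\<close>\<close>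

definition rinv_z :: "int \<Rightarrow> int \<Rightarrow> ('v \<Rightarrow> int) \<Rightarrow> ('v \<Rightarrow> 'e) \<Rightarrow> bool" where
  "rinv_z A B c r \<longleftrightarrow> 0 \<le> c v \<and> 0 \<le> c w \<and> (\<exists>i\<in>{0..<m}. \<exists>j\<in>{0..<n}. r v = C i \<and> r w = F j
     \<and> (i + c v) mod m = A mod m \<and> (j + c w) mod n = B mod n)"

lemma rinv_z_I:
  assumes "0 \<le> c v" "0 \<le> c w" "i \<in> {0..<m}" "j \<in> {0..<n}" "r v = C i" "r w = F j"
    "(i + c v) mod m = A mod m" "(j + c w) mod n = B mod n"
  shows "rinv_z A B c r"
  using assms unfolding rinv_z_def by blast

text \<open>Every chip goes straight into the root, so the two ends do not interact: a firing trades
  one chip for one advance of the rotor.\<close>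

lemma rstep_z:
  assumes "rstep G z (c, r) (c', r')" and inv: "rinv_z A B c r"
  shows "rinv_z A B c' r' \<and> nat (c' v + c' w) < nat (c v + c w)"
proof -
  obtain i j where ij: "i \<in> {0..<m}" "j \<in> {0..<n}" "r v = C i" "r w = F j"
      and mods: "(i + c v) mod m = A mod m" "(j + c w) mod n = B mod n"
    using inv unfolding rinv_z_def by blast
  have nonneg: "0 \<le> c v" "0 \<le> c w" using inv unfolding rinv_z_def by blast+
  obtain y where y: "y \<in> {v, z, w}" "y \<noteq> z" "c y > 0"
    and c': "c' = c(y := c y - 1, oth G (rot G y (r y)) y := c (oth G (rot G y (r y)) y) + 1)"
    and r': "r' = r(y := rot G y (r y))"
    using assms(1) unfolding rstep_def verts_eq Let_def by auto
  consider "y = v" | "y = w" using y by blast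
  then show ?thesis
  proof cases
    case 1
    have r'_eq: "r' v = C ((i + 1) mod m)" "r' w = F j"
      using r' 1 ij rot_v distinct_verts by auto
    have c'_eq: "c' v = c v - 1" "c' w = c w"
      using c' 1 ij rot_v oth_C[OF mod_m] distinct_verts by auto
    have "((i + 1) mod m + (c v - 1)) mod m = A mod m"
      using mods mod_add_left_eq[of "i + 1" m "c v - 1"] by simp
    then show ?thesis
      using rinv_z_I[of c' "(i + 1) mod m" j r' A B] ij mods y(3) 1 mod_m nonneg
      by (simp add: r'_eq c'_eq)
  next
    case 2
    have r'_eq: "r' v = C i" "r' w = F ((j + 1) mod n)"
      using r' 2 ij rot_w distinct_verts by auto
    have c'_eq: "c' v = c v" "c' w = c w - 1"
      using c' 2 ij rot_w oth_F[OF mod_n] distinct_verts by auto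
    have "((j + 1) mod n + (c w - 1)) mod n = B mod n"
      using mods mod_add_left_eq[of "j + 1" n "c w - 1"] by simp
    then show ?thesis
      using rinv_z_I[of c' i "(j + 1) mod n" r' A B] ij mods y(3) 2 mod_n nonneg
      by (simp add: r'_eq c'_eq)
  qed
qed

lemma rsteps_z:
  assumes "(rstep G z)\<^sup>*\<^sup>* s s'" "rinv_z A B (fst s) (snd s)"
  shows "rinv_z A B (fst s') (snd s')"
  using assms
proof (induction rule: rtranclp_induct)
  case (step s' s'')
  then show ?case using rstep_z[of "fst s'" "snd s'" "fst s''" "snd s''" A B] by simp
qed auto

lemma rotor_terminates_z:
  assumes "rinv_z A B c r"
  shows "\<exists>c' r'. (rstep G z)\<^sup>*\<^sup>* (c, r) (c', r') \<and> (\<forall>y\<in>verts G - {z}. c' y = 0)"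
  using assms
proof (induction "nat (c v + c w)" arbitrary: c r rule: less_induct)
  case less
  show ?case
  proof (cases "\<forall>y\<in>verts G - {z}. c y = 0")
    case False
    then have "c v \<noteq> 0 \<or> c w \<noteq> 0" unfolding verts_eq by auto
    then obtain y where "y \<in> verts G - {z}" "c y > 0"
      using less(2) distinct_verts unfolding rinv_z_def verts_eq
      by (metis (no_types, lifting) Diff_iff empty_iff insert_iff order_le_less)
    then obtain c' r' where s: "rstep G z (c, r) (c', r')" using rstep_exists by blast
    note s' = rstep_z[OF s less(2)]
    show ?thesis using less(1)[of c' r'] s' s by (meson converse_rtranclp_into_rtranclp)
  qed blast
qed

lemma torient_z_v: "torient G (tr a b) z v = C (a mod m)"
proof -
  let ?c = "C (a mod m)" and ?f = "F (b mod n)"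
  have "tr a b - {?c} = {?f}" unfolding tr_def using C_neq_F[OF mod_m mod_n] by auto
  moreover have "?c \<in> inc G v" "?f \<notin> inc G v"
    unfolding inc_v using imageI[OF mod_m, of C a] imageI[OF mod_n, of F b] disjoint by blast+
  moreover have "{v, z} \<noteq> {z, w}" using distinct_verts by (auto simp: doubleton_eq_iff)
  then have "\<not> reach G {?f} v z"
    using reach_F[of "{?f}" v z] imageI[OF mod_n, of F b] distinct_verts by blast
  moreover have "e \<in> tr a b \<longleftrightarrow> e = ?c \<or> e = ?f" for e by (simp add: tr_def)
  ultimately show ?thesis
    unfolding torient_def by (metis (mono_tags, lifting) the_equality)
qed

lemma torient_z_w: "torient G (tr a b) z w = F (b mod n)"
  using banana_chain.torient_z_v[OF swapped, of b a] unfolding swap_tr .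

lemma rotor_z: "rotor G z (cls 0 a b) (tr i j) = tr (i + a) (j + b)"
proof -
  let ?r = "torient G (tr i j) z"
  have init: "rinv_z (i + a) (j + b) D ?r"
    if "D \<in> cls 0 a b" "0 \<le> D v" "0 \<le> D w" for D
  proof -
    have D: "D v mod m = a mod m" "D w mod n = b mod n"
      using that(1) unfolding cls_def by auto
    have "(i mod m + D v) mod m = (i + a) mod m" "(j mod n + D w) mod n = (j + b) mod n"
      using D by (intro mod_add_cong; simp)+
    then show ?thesis
      unfolding rinv_z_def torient_z_v torient_z_w using that mod_m mod_n by blast
  qed
  have final: "r ` (verts G - {z}) = tr (i + a) (j + b)"
    if "rinv_z (i + a) (j + b) c r" "\<forall>y\<in>verts G - {z}. c y = 0" for c r
  proof -
    have c: "c v = 0" "c w = 0" using that(2) distinct_verts unfolding verts_eq by auto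
    have "r ` (verts G - {z}) = {r v, r w}"
      unfolding verts_eq using distinct_verts by auto
    then show ?thesis using that(1) unfolding rinv_z_def c tr_def by auto
  qed
  have uniq: "T' = tr (i + a) (j + b)" if "rotor_rel G z (cls 0 a b) (tr i j) T'" for T'
  proof -
    obtain D c r where D: "D \<in> cls 0 a b" "\<forall>y\<in>verts G - {z}. 0 \<le> D y"
        and s: "(rstep G z)\<^sup>*\<^sup>* (D, ?r) (c, r)" "\<forall>y\<in>verts G - {z}. c y = 0"
        and T': "T' = r ` (verts G - {z})"
      using \<open>rotor_rel G z (cls 0 a b) (tr i j) T'\<close> unfolding rotor_rel_def by blast
    have "rinv_z (i + a) (j + b) D ?r"
      using init D distinct_verts unfolding verts_eq by auto
    then show ?thesis using rsteps_z[OF s(1)] final[of c r] s(2) T' by simp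
  qed
  have D: "divisor 0 (a mod m) (b mod n) \<in> cls 0 a b" "0 \<le> a mod m" "0 \<le> b mod n"
    using m_pos n_pos by (auto intro: divisor_in_cls)
  then have i: "rinv_z (i + a) (j + b) (divisor 0 (a mod m) (b mod n)) ?r" using init by simp
  obtain c r where s: "(rstep G z)\<^sup>*\<^sup>* (divisor 0 (a mod m) (b mod n), ?r) (c, r)"
      "\<forall>y\<in>verts G - {z}. c y = 0"
    using rotor_terminates_z[OF i] by blast
  have "\<forall>y\<in>verts G - {z}. 0 \<le> divisor 0 (a mod m) (b mod n) y" using D unfolding verts_eq by auto
  then have "rotor_rel G z (cls 0 a b) (tr i j) (r ` (verts G - {z}))"
    using D s unfolding rotor_rel_def by blast
  then show ?thesis unfolding rotor_def using uniq by (metis someI)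
qed

section \<open>The Bernardi process\<close>

text \<open>
  The position of a half-edge in the Bernardi tour of \<open>{C i, F j}\<close>, which up to its starting point
  is, at \<open>v\<close>, \<open>C (i+1) \<dots> C (m-1), C 0 \<dots> C i\<close>; at \<open>z\<close>, \<open>C (i+1) \<dots> C (m-1), F 0 \<dots> F j\<close>; at \<open>w\<close>,
  \<open>F (j+1) \<dots> F (n-1), F 0 \<dots> F j\<close>; at \<open>z\<close>, \<open>F (j+1) \<dots> F (n-1), C 0 \<dots> C i\<close>.
\<close>

definition tour_pos :: "int \<Rightarrow> int \<Rightarrow> 'e \<times> 'v \<Rightarrow> int" where
  "tour_pos i j d = (let k = idx_C (fst d); l = idx_F (fst d) in
     if snd d = v then (if k > i then k - i - 1 else m + k - i - 1)
     else if snd d = w then (if l > j then 2 * m - i + l - 1 else 2 * m - i + n + l - 1)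
     else if fst d \<in> C ` {0..<m} then (if k > i then m + k - i - 1 else 2 * m + 2 * n - 1 - i + k)
     else (if l > j then 2 * m - i + n + l - 1 else 2 * m - 1 - i + l))"

lemma tour_pos_simps:
  "k \<in> {0..<m} \<Longrightarrow> tour_pos i j (C k, v) = (if k > i then k - i - 1 else m + k - i - 1)"
  "k \<in> {0..<m} \<Longrightarrow> tour_pos i j (C k, z) = (if k > i then m + k - i - 1 else 2 * m + 2 * n - 1 - i + k)"
  "l \<in> {0..<n} \<Longrightarrow> tour_pos i j (F l, z) = (if l > j then 2 * m - i + n + l - 1 else 2 * m - 1 - i + l)"
  "l \<in> {0..<n} \<Longrightarrow> tour_pos i j (F l, w) = (if l > j then 2 * m - i + l - 1 else 2 * m - i + n + l - 1)"
proof -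
  assume "l \<in> {0..<n}"
  then have "F l \<notin> C ` {0..<m}" using C_neq_F by (metis imageE)
  then show "tour_pos i j (F l, z) = (if l > j then 2 * m - i + n + l - 1 else 2 * m - 1 - i + l)"
    using \<open>l \<in> {0..<n}\<close> distinct_verts by (simp add: tour_pos_def)
qed (use distinct_verts in \<open>auto simp: tour_pos_def\<close>)

lemma dart_in_darts:
  "k \<in> {0..<m} \<Longrightarrow> (C k, v) \<in> darts G" "k \<in> {0..<m} \<Longrightarrow> (C k, z) \<in> darts G"
  "l \<in> {0..<n} \<Longrightarrow> (F l, z) \<in> darts G" "l \<in> {0..<n} \<Longrightarrow> (F l, w) \<in> darts G"
  unfolding darts_eq by auto

lemma bstep_simps:
  assumes "i \<in> {0..<m}" "j \<in> {0..<n}"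
  shows "k \<in> {0..<m} \<Longrightarrow> bstep G (tr i j) (C k, v) =
      (if k = i then (if k = m - 1 then (F 0, z) else (C (k + 1), z)) else (C ((k + 1) mod m), v))"
    and "k \<in> {0..<m} \<Longrightarrow> bstep G (tr i j) (C k, z) =
      (if k = i then (C ((k + 1) mod m), v) else if k = m - 1 then (F 0, z) else (C (k + 1), z))"
    and "l \<in> {0..<n} \<Longrightarrow> bstep G (tr i j) (F l, z) =
      (if l = j then (F ((l + 1) mod n), w) else if l = n - 1 then (C 0, z) else (F (l + 1), z))"
    and "l \<in> {0..<n} \<Longrightarrow> bstep G (tr i j) (F l, w) =
      (if l = j then (if l = n - 1 then (C 0, z) else (F (l + 1), z)) else (F ((l + 1) mod n), w))"
proof -
  have T: "k \<in> {0..<m} \<Longrightarrow> C k \<in> tr i j \<longleftrightarrow> k = i" "l \<in> {0..<n} \<Longrightarrow> F l \<in> tr i j \<longleftrightarrow> l = j" for k l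
    using assms C_eq_iff[of k i] F_eq_iff[of l j] C_neq_F[of k j] C_neq_F[of i l]
    unfolding tr_def by auto
  show "k \<in> {0..<m} \<Longrightarrow> bstep G (tr i j) (C k, v) =
      (if k = i then (if k = m - 1 then (F 0, z) else (C (k + 1), z)) else (C ((k + 1) mod m), v))"
    using T(1)[of k] oth_C[of k] rot_v[of k] rot_z_C[of k] unfolding bstep_def Let_def by auto
  show "k \<in> {0..<m} \<Longrightarrow> bstep G (tr i j) (C k, z) =
      (if k = i then (C ((k + 1) mod m), v) else if k = m - 1 then (F 0, z) else (C (k + 1), z))"
    using T(1)[of k] oth_C[of k] rot_v[of k] rot_z_C[of k] unfolding bstep_def Let_def by auto
  show "l \<in> {0..<n} \<Longrightarrow> bstep G (tr i j) (F l, z) =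
      (if l = j then (F ((l + 1) mod n), w) else if l = n - 1 then (C 0, z) else (F (l + 1), z))"
    using T(2)[of l] oth_F[of l] rot_w[of l] rot_z_F[of l] unfolding bstep_def Let_def by auto
  show "l \<in> {0..<n} \<Longrightarrow> bstep G (tr i j) (F l, w) =
      (if l = j then (if l = n - 1 then (C 0, z) else (F (l + 1), z)) else (F ((l + 1) mod n), w))"
    using T(2)[of l] oth_F[of l] rot_w[of l] rot_z_F[of l] unfolding bstep_def Let_def by auto
qed

lemma bstep_closed:
  assumes "i \<in> {0..<m}" "j \<in> {0..<n}" "d \<in> darts G"
  shows "bstep G (tr i j) d \<in> darts G"
  using assms(3)
proof (cases rule: dart_cases)
  case (Cv k)
  then show ?thesis
    using bstep_simps(1)[OF assms(1,2) Cv(1)] dart_in_darts mod_m[of "k + 1"] n_pos by auto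
next
  case (Cz k)
  then show ?thesis
    using bstep_simps(2)[OF assms(1,2) Cz(1)] dart_in_darts mod_m[of "k + 1"] n_pos by auto
next
  case (Fz l)
  then show ?thesis
    using bstep_simps(3)[OF assms(1,2) Fz(1)] dart_in_darts mod_n[of "l + 1"] m_pos by auto
next
  case (Fw l)
  then show ?thesis
    using bstep_simps(4)[OF assms(1,2) Fw(1)] dart_in_darts mod_n[of "l + 1"] m_pos by auto
qed

lemma tour_pos_range:
  assumes "i \<in> {0..<m}" "j \<in> {0..<n}" "d \<in> darts G"
  shows "tour_pos i j d \<in> {0..<2 * m + 2 * n}"
  using assms(3) by (cases rule: dart_cases) (use assms(1,2) in \<open>auto simp: tour_pos_simps\<close>)

text \<open>The tour crosses between vertices only along \<open>C i\<close> and \<open>F j\<close>.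
  Checking all transitions shows that it runs through all \<open>2 * m + 2 * n\<close> half-edges in
  one cycle, whatever the starting point.\<close>

lemma tour_pos_step:
  assumes ij: "i \<in> {0..<m}" "j \<in> {0..<n}" and d: "d \<in> darts G"
  shows "tour_pos i j (bstep G (tr i j) d) = (tour_pos i j d + 1) mod (2 * m + 2 * n)"
proof -
  have succ: "(tour_pos i j d + 1) mod (2 * m + 2 * n)
      = (if tour_pos i j d = 2 * m + 2 * n - 1 then 0 else tour_pos i j d + 1)"
    using mod_succ[OF tour_pos_range[OF assms]] .
  have zero: "0 \<in> {0..<m}" "0 \<in> {0..<n}" using m_pos n_pos by auto
  from d show ?thesis unfolding succ
  proof (cases rule: dart_cases)
    case (Cv k)
    have k1: "k \<noteq> m - 1 \<Longrightarrow> k + 1 \<in> {0..<m}" using Cv by auto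
    show "tour_pos i j (bstep G (tr i j) d)
      = (if tour_pos i j d = 2 * m + 2 * n - 1 then 0 else tour_pos i j d + 1)"
      unfolding Cv(2) bstep_simps(1)[OF ij Cv(1)] mod_succ[OF Cv(1)]
      using Cv(1) k1 zero ij by (auto simp: tour_pos_simps)
  next
    case (Cz k)
    have k1: "k \<noteq> m - 1 \<Longrightarrow> k + 1 \<in> {0..<m}" using Cz by auto
    show "tour_pos i j (bstep G (tr i j) d)
      = (if tour_pos i j d = 2 * m + 2 * n - 1 then 0 else tour_pos i j d + 1)"
      unfolding Cz(2) bstep_simps(2)[OF ij Cz(1)] mod_succ[OF Cz(1)]
      using Cz(1) k1 zero ij by (auto simp: tour_pos_simps)
  next
    case (Fz l)
    have l1: "l \<noteq> n - 1 \<Longrightarrow> l + 1 \<in> {0..<n}" using Fz by auto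
    show "tour_pos i j (bstep G (tr i j) d)
      = (if tour_pos i j d = 2 * m + 2 * n - 1 then 0 else tour_pos i j d + 1)"
      unfolding Fz(2) bstep_simps(3)[OF ij Fz(1)] mod_succ[OF Fz(1)]
      using Fz(1) l1 zero ij by (auto simp: tour_pos_simps)
  next
    case (Fw l)
    have l1: "l \<noteq> n - 1 \<Longrightarrow> l + 1 \<in> {0..<n}" using Fw by auto
    show "tour_pos i j (bstep G (tr i j) d)
      = (if tour_pos i j d = 2 * m + 2 * n - 1 then 0 else tour_pos i j d + 1)"
      unfolding Fw(2) bstep_simps(4)[OF ij Fw(1)] mod_succ[OF Fw(1)]
      using Fw(1) l1 zero ij by (auto simp: tour_pos_simps)
  qed
qed

lemma tour_pos_inj:
  assumes ij: "i \<in> {0..<m}" "j \<in> {0..<n}"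
  shows "inj_on (tour_pos i j) (darts G)"
proof (rule inj_onI)
  fix d d' assume d: "d \<in> darts G" and d': "d' \<in> darts G" and "tour_pos i j d = tour_pos i j d'"
  with ij show "d = d'"
    by (cases rule: dart_cases[OF d]; cases rule: dart_cases[OF d'])
      (auto simp: tour_pos_simps split: if_splits)
qed

lemma loopless: "e \<in> edges G \<Longrightarrow> fst (ends G e) \<noteq> snd (ends G e)"
  using distinct_verts unfolding edges_eq by (auto dest!: ends_C ends_F simp del: atLeastLessThan_iff)

text \<open>Only the counts at \<open>v\<close> and \<open>w\<close> are needed to name a class. The
  degree comes from each of the \<open>m + n - 2\<close> non-tree edges dropping one chip, at
  whichever end is met first.\<close>

lemma bdiv_eq:
  assumes ij: "i \<in> {0..<m}" "j \<in> {0..<n}" and start: "(e0, u) \<in> darts G"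
  shows "bdiv G (tr i j) u e0 v = int (card {k \<in> {0..<m}. k \<noteq> i \<and>
      cyclic_less (tour_pos i j (e0, u)) (tour_pos i j (C k, v)) (tour_pos i j (C k, z))})"
    and "bdiv G (tr i j) u e0 w = int (card {l \<in> {0..<n}. l \<noteq> j \<and>
      cyclic_less (tour_pos i j (e0, u)) (tour_pos i j (F l, w)) (tour_pos i j (F l, z))})"
    and "cdeg G (bdiv G (tr i j) u e0) = m + n - 2"
proof -
  define rel where "rel d = (tour_pos i j d - tour_pos i j (e0, u)) mod (2 * m + 2 * n)" for d
  have rel_less: "rel d < rel d' \<longleftrightarrow>
      cyclic_less (tour_pos i j (e0, u)) (tour_pos i j d) (tour_pos i j d')"
    if "d \<in> darts G" "d' \<in> darts G" for d d'
    unfolding rel_def using that start by (intro mod_diff_less_iff tour_pos_range ij)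
  let ?B = "bdiv G (tr i j) u e0"
  have B: "?B y = int (card {e \<in> inc G y. e \<notin> tr i j \<and> rel (e, y) < rel (e, oth G e y)})" for y
    unfolding rel_def
    by (rule bdiv_eq_card[OF loopless bstep_closed[OF ij] tour_pos_range[OF ij]
          tour_pos_step[OF ij] tour_pos_inj[OF ij] start])
  have T: "k \<in> {0..<m} \<Longrightarrow> C k \<in> tr i j \<longleftrightarrow> k = i" "l \<in> {0..<n} \<Longrightarrow> F l \<in> tr i j \<longleftrightarrow> l = j" for k l
    using ij C_eq_iff[of k i] F_eq_iff[of l j] C_neq_F[of k j] C_neq_F[of i l]
    unfolding tr_def by auto
  have rel_eq: "rel d = rel d' \<longleftrightarrow> d = d'" if "d \<in> darts G" "d' \<in> darts G" for d d'
  proof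
    assume "rel d = rel d'"
    then have "tour_pos i j d mod (2 * m + 2 * n) = tour_pos i j d' mod (2 * m + 2 * n)"
      unfolding rel_def mod_eq_dvd_iff by simp
    then have "tour_pos i j d = tour_pos i j d'"
      using tour_pos_range[OF ij that(1)] tour_pos_range[OF ij that(2)] by simp
    then show "d = d'" using inj_onD[OF tour_pos_inj[OF ij]] that by blast
  qed simp
  let ?Cv = "{k \<in> {0..<m}. k \<noteq> i \<and> rel (C k, v) < rel (C k, z)}"
  let ?Cz = "{k \<in> {0..<m}. k \<noteq> i \<and> rel (C k, z) < rel (C k, v)}"
  let ?Fw = "{l \<in> {0..<n}. l \<noteq> j \<and> rel (F l, w) < rel (F l, z)}"
  let ?Fz = "{l \<in> {0..<n}. l \<noteq> j \<and> rel (F l, z) < rel (F l, w)}"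
  have fin: "finite {k \<in> {a..<b}. P k}" for a b :: int and P
    by (rule finite_subset[of _ "{a..<b}"]) auto
  have card_C: "card (C ` {k \<in> {0..<m}. P k}) = card {k \<in> {0..<m}. P k}" for P
    by (intro card_image inj_on_subset[OF inj_C]) auto
  have card_F: "card (F ` {l \<in> {0..<n}. P l}) = card {l \<in> {0..<n}. P l}" for P
    by (intro card_image inj_on_subset[OF inj_F]) auto
  have Ev: "{e \<in> inc G v. e \<notin> tr i j \<and> rel (e, v) < rel (e, oth G e v)} = C ` ?Cv"
    unfolding inc_v by (auto simp: T oth_C simp del: atLeastLessThan_iff)
  have v: "?B v = int (card ?Cv)"
    unfolding B Ev card_C ..
  have Ew: "{e \<in> inc G w. e \<notin> tr i j \<and> rel (e, w) < rel (e, oth G e w)} = F ` ?Fw"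
    unfolding inc_w by (auto simp: T oth_F simp del: atLeastLessThan_iff)
  have w: "?B w = int (card ?Fw)"
    unfolding B Ew card_F ..
  have Ez: "{e \<in> inc G z. e \<notin> tr i j \<and> rel (e, z) < rel (e, oth G e z)} = C ` ?Cz \<union> F ` ?Fz"
    unfolding inc_z by (auto simp: T oth_C oth_F simp del: atLeastLessThan_iff)
  have "C ` ?Cz \<inter> F ` ?Fz = {}" using disjoint by blast
  then have cU: "card (C ` ?Cz \<union> F ` ?Fz) = card (C ` ?Cz) + card (F ` ?Fz)"
    by (intro card_Un_disjoint finite_imageI fin)
  have z: "?B z = int (card ?Cz) + int (card ?Fz)"
    unfolding B Ez cU card_C card_F by (rule of_nat_add)
  have Cv: "?Cv = {k \<in> {0..<m}. k \<noteq> i \<and>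
      cyclic_less (tour_pos i j (e0, u)) (tour_pos i j (C k, v)) (tour_pos i j (C k, z))}"
    using rel_less[OF dart_in_darts(1,2)] by blast
  show "?B v = int (card {k \<in> {0..<m}. k \<noteq> i \<and>
      cyclic_less (tour_pos i j (e0, u)) (tour_pos i j (C k, v)) (tour_pos i j (C k, z))})"
    using v unfolding Cv .
  have Fw: "?Fw = {l \<in> {0..<n}. l \<noteq> j \<and>
      cyclic_less (tour_pos i j (e0, u)) (tour_pos i j (F l, w)) (tour_pos i j (F l, z))}"
    using rel_less[OF dart_in_darts(4,3)] by blast
  show "?B w = int (card {l \<in> {0..<n}. l \<noteq> j \<and>
      cyclic_less (tour_pos i j (e0, u)) (tour_pos i j (F l, w)) (tour_pos i j (F l, z))})"
    using w unfolding Fw .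
  \<comment> \<open>The two half-edges have different positions, so the edge is counted at exactly
    one of its ends.\<close>
  have "rel (C k, v) < rel (C k, z) \<or> rel (C k, z) < rel (C k, v)" if "k \<in> {0..<m}" for k
    using rel_eq[OF dart_in_darts(1,2)[OF that]] distinct_verts by (simp add: neq_iff[symmetric])
  then have "?Cv \<union> ?Cz = {0..<m} - {i}" by blast
  moreover have "?Cv \<inter> ?Cz = {}" by (blast dest: less_asym)
  then have "card (?Cv \<union> ?Cz) = card ?Cv + card ?Cz" by (rule card_Un_disjoint[OF fin fin])
  ultimately have cardm: "card ?Cv + card ?Cz = card ({0..<m} - {i})" by simp
  have "rel (F l, w) < rel (F l, z) \<or> rel (F l, z) < rel (F l, w)" if "l \<in> {0..<n}" for l
    using rel_eq[OF dart_in_darts(4,3)[OF that]] distinct_verts by (simp add: neq_iff[symmetric])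
  then have "?Fw \<union> ?Fz = {0..<n} - {j}" by blast
  moreover have "?Fw \<inter> ?Fz = {}" by (blast dest: less_asym)
  then have "card (?Fw \<union> ?Fz) = card ?Fw + card ?Fz" by (rule card_Un_disjoint[OF fin fin])
  ultimately have cardn: "card ?Fw + card ?Fz = card ({0..<n} - {j})" by simp
  have "int (card ({0..<m} - {i})) = m - 1" "int (card ({0..<n} - {j})) = n - 1"
    using ij by auto
  then show "cdeg G ?B = m + n - 2"
    unfolding cdeg_eq v w z using cardm cardn by linarith
qed

text \<open>Starting at \<open>C s\<close>, the tour reads the edges at \<open>v\<close> from
  \<open>C s\<close> up to \<open>C i\<close> before it ever leaves \<open>v\<close>; these, except
  \<open>C i\<close>, put their chip on \<open>v\<close>. It enters \<open>w\<close> only after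
  \<open>F 0\<close> to \<open>F j\<close> were met at \<open>z\<close>, which leaves the chips of
  \<open>F (j + 1)\<close> to \<open>F (n - 1)\<close> for \<open>w\<close>.\<close>

lemma bdiv_v_start:
  assumes ij: "i \<in> {0..<m}" "j \<in> {0..<n}" and s: "s \<in> {0..<m}"
  shows "pcls G (bdiv G (tr i j) v (C s)) = cls (m + n - 2) (i + - s) (- j + -1)"
proof -
  note start = dart_in_darts(1)[OF s]
  note B = bdiv_eq[OF ij start]
  let ?p = "tour_pos i j"
  have "{k \<in> {0..<m}. k \<noteq> i \<and> cyclic_less (?p (C s, v)) (?p (C k, v)) (?p (C k, z))}
      = (if s \<le> i then {s..<i} else {s..<m} \<union> {0..<i})" (is "?A = _")
  proof (rule set_eqI)
    fix k
    show "k \<in> ?A \<longleftrightarrow> k \<in> (if s \<le> i then {s..<i} else {s..<m} \<union> {0..<i})"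
    proof (cases "k \<in> {0..<m}")
      case True
      then show ?thesis
        using ij s by (auto simp: cyclic_less_def tour_pos_simps)
    qed (use ij s in auto)
  qed
  moreover have "card ({s..<m} \<union> {0..<i}) = nat (m - s) + nat i" if "\<not> s \<le> i"
    using that by (subst card_Un_disjoint) auto
  ultimately have "bdiv G (tr i j) v (C s) v = (if s \<le> i then i + - s else m + (i + - s))"
    unfolding B(1) using ij s by simp
  then have "bdiv G (tr i j) v (C s) v mod m = (i + - s) mod m" by (simp del: add_uminus_conv_diff)
  moreover have "{l \<in> {0..<n}. l \<noteq> j \<and> cyclic_less (?p (C s, v)) (?p (F l, w)) (?p (F l, z))} = {j + 1..<n}" (is "?A = _")
  proof (rule set_eqI)
    fix l
    show "l \<in> ?A \<longleftrightarrow> l \<in> {j + 1..<n}"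
    proof (cases "l \<in> {0..<n}")
      case True
      then show ?thesis
        using ij s by (auto simp: cyclic_less_def tour_pos_simps)
    qed (use ij s in auto)
  qed
  then have "bdiv G (tr i j) v (C s) w = n + (- j + -1)"
    unfolding B(2) using ij by simp
  then have "bdiv G (tr i j) v (C s) w mod n = (- j + -1) mod n" by (simp only: mod_add_self1)
  ultimately show ?thesis unfolding pcls_eq B(3) by (rule cls_cong)
qed

text \<open>Now \<open>v\<close> is entered through \<open>C i\<close> instead of left through it:
  the edges from \<open>C s\<close> cyclically up to \<open>C i\<close> were met at \<open>z\<close>
  first, and those from \<open>C (i + 1)\<close> up to \<open>C (s - 1)\<close> put their chip on
  \<open>v\<close>. Hence the sign of \<open>i\<close> is opposite to that for a start at
  \<open>v\<close>.\<close>

lemma bdiv_z_start: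
  assumes ij: "i \<in> {0..<m}" "j \<in> {0..<n}" and s: "s \<in> {0..<m}"
  shows "pcls G (bdiv G (tr i j) z (C s)) = cls (m + n - 2) (- i + (s - 1)) (- j + -1)"
proof -
  note start = dart_in_darts(2)[OF s]
  note B = bdiv_eq[OF ij start]
  let ?p = "tour_pos i j"
  have "{k \<in> {0..<m}. k \<noteq> i \<and> cyclic_less (?p (C s, z)) (?p (C k, v)) (?p (C k, z))}
      = (if i < s then {i + 1..<s} else {i + 1..<m} \<union> {0..<s})" (is "?A = _")
  proof (rule set_eqI)
    fix k
    show "k \<in> ?A \<longleftrightarrow> k \<in> (if i < s then {i + 1..<s} else {i + 1..<m} \<union> {0..<s})"
    proof (cases "k \<in> {0..<m}")
      case True
      then show ?thesis
        using ij s by (auto simp: cyclic_less_def tour_pos_simps)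
    qed (use ij s in auto)
  qed
  moreover have "card ({i + 1..<m} \<union> {0..<s}) = nat (m - (i + 1)) + nat s" if "\<not> i < s"
    using that by (subst card_Un_disjoint) auto
  ultimately have "bdiv G (tr i j) z (C s) v = (if i < s then - i + (s - 1) else m + (- i + (s - 1)))"
    unfolding B(1) using ij s by simp
  then have "bdiv G (tr i j) z (C s) v mod m = (- i + (s - 1)) mod m"
    by (simp del: uminus_add_conv_diff)
  moreover have "{l \<in> {0..<n}. l \<noteq> j \<and> cyclic_less (?p (C s, z)) (?p (F l, w)) (?p (F l, z))} = {j + 1..<n}" (is "?A = _")
  proof (rule set_eqI)
    fix l
    show "l \<in> ?A \<longleftrightarrow> l \<in> {j + 1..<n}"
    proof (cases "l \<in> {0..<n}")
      case True
      then show ?thesis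
        using ij s by (auto simp: cyclic_less_def tour_pos_simps)
    qed (use ij s in auto)
  qed
  then have "bdiv G (tr i j) z (C s) w = n + (- j + -1)"
    unfolding B(2) using ij by simp
  then have "bdiv G (tr i j) z (C s) w mod n = (- j + -1) mod n" by (simp only: mod_add_self1)
  ultimately show ?thesis unfolding pcls_eq B(3) by (rule cls_cong)
qed

text \<open>Adding a class compares two trees with the same offsets \<open>p\<close> and
  \<open>q\<close>. As the starting edge enters the divisor classes only through these, it
  disappears from the torsor and only the signs remain.\<close>

lemma bern_eq:
  assumes bdiv: "\<And>i j. i \<in> {0..<m} \<Longrightarrow> j \<in> {0..<n} \<Longrightarrow>
      pcls G (bdiv G (tr i j) u e0) = cls d (\<sigma> * i + p) (\<tau> * j + q)"
    and signs: "\<sigma> \<in> {1, -1}" "\<tau> \<in> {1, -1}"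
  shows "bern G u e0 (cls 0 a b) (tr i j) = tr (i + \<sigma> * a) (j + \<tau> * b)"
proof -
  have bdiv': "pcls G (bdiv G (tr i j) u e0) = cls d (\<sigma> * i + p) (\<tau> * j + q)" for i j
  proof -
    have "pcls G (bdiv G (tr (i mod m) (j mod n)) u e0) = cls d (\<sigma> * (i mod m) + p) (\<tau> * (j mod n) + q)"
      using bdiv[OF mod_m mod_n] .
    also have "\<dots> = cls d (\<sigma> * i + p) (\<tau> * j + q)"
      by (rule cls_cong; rule mod_add_cong; simp add: mod_mult_right_eq)
    finally show ?thesis by (simp add: tr_mod)
  qed
  have "pcls G (bdiv G (tr i' j') u e0) = pic_add (pcls G (bdiv G (tr i j) u e0)) (cls 0 a b)
      \<longleftrightarrow> tr i' j' = tr (i + \<sigma> * a) (j + \<tau> * b)" for i' j'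
    unfolding bdiv' pic_add_cls add_0_right cls_eq_iff tr_eq_iff
    using mod_sign_eq_iff[OF signs(1)] mod_sign_eq_iff[OF signs(2)] by simp
  then show ?thesis
    unfolding bern_def sptrees_eq by (intro the_equality) auto
qed

lemma bern_v:
  assumes "e0 \<in> inc G v"
  shows "bern G v e0 (cls 0 a b) (tr i j) = tr (i + a) (j - b)"
proof -
  obtain s where s: "s \<in> {0..<m}" "e0 = C s" using assms unfolding inc_v by blast
  have "bern G v e0 (cls 0 a b) (tr i j) = tr (i + 1 * a) (j + (-1) * b)"
    by (rule bern_eq[where d = "m + n - 2" and p = "- s" and q = "-1"])
      (use bdiv_v_start[OF _ _ s(1)] s(2) in \<open>simp_all\<close>)
  then show ?thesis by simp
qed

lemma bern_w:
  assumes "e0 \<in> inc G w"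
  shows "bern G w e0 (cls 0 a b) (tr i j) = tr (i - a) (j + b)"
  using banana_chain.bern_v[OF swapped assms, of b a j i] unfolding swap_tr swap_cls .

lemma bern_z_C:
  assumes "e0 \<in> C ` {0..<m}"
  shows "bern G z e0 (cls 0 a b) (tr i j) = tr (i - a) (j - b)"
proof -
  obtain s where s: "s \<in> {0..<m}" "e0 = C s" using assms by blast
  have "bern G z e0 (cls 0 a b) (tr i j) = tr (i + (-1) * a) (j + (-1) * b)"
    by (rule bern_eq[where d = "m + n - 2" and p = "s - 1" and q = "-1"])
      (use bdiv_z_start[OF _ _ s(1)] s(2) in \<open>simp_all\<close>)
  then show ?thesis by simp
qed

text \<open>The starting edge may lie in either bundle; reversing the chain exchanges the two cases,
  and both signs are negative in each.\<close>

lemma bern_z: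
  assumes "e0 \<in> inc G z"
  shows "bern G z e0 (cls 0 a b) (tr i j) = tr (i - a) (j - b)"
  using assms bern_z_C banana_chain.bern_z_C[OF swapped, of e0 b a j i]
  unfolding swap_tr swap_cls inc_z by blast

section \<open>Genus\<close>

lemma fperm_simps:
  "k \<in> {0..<m} \<Longrightarrow> fperm G (C k, v) = (C ((k + 1) mod m), z)"
  "k \<in> {0..<m} \<Longrightarrow> fperm G (C k, z) = (if k = m - 1 then (F 0, w) else (C (k + 1), v))"
  "l \<in> {0..<n} \<Longrightarrow> fperm G (F l, z) = (if l = n - 1 then (C 0, v) else (F (l + 1), w))"
  "l \<in> {0..<n} \<Longrightarrow> fperm G (F l, w) = (F ((l + 1) mod n), z)"
proof -
  have zero: "0 \<in> {0..<m}" "0 \<in> {0..<n}" using m_pos n_pos by auto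
  show "fperm G (C k, v) = (C ((k + 1) mod m), z)" if "k \<in> {0..<m}"
    unfolding fperm_def Let_def fst_conv snd_conv rot_v[OF that] oth_C(1)[OF mod_m] ..
  show "fperm G (F l, w) = (F ((l + 1) mod n), z)" if "l \<in> {0..<n}"
    unfolding fperm_def Let_def fst_conv snd_conv rot_w[OF that] oth_F(2)[OF mod_n] ..
  show "fperm G (C k, z) = (if k = m - 1 then (F 0, w) else (C (k + 1), v))" if "k \<in> {0..<m}"
  proof (cases "k = m - 1")
    case False
    then have "k + 1 \<in> {0..<m}" using that by auto
    then show ?thesis
      using False rot_z_C[OF that] oth_C(2)[of "k + 1"] by (simp add: fperm_def)
  qed (use rot_z_C[OF that] oth_F(1)[OF zero(2)] in \<open>simp add: fperm_def\<close>)
  show "fperm G (F l, z) = (if l = n - 1 then (C 0, v) else (F (l + 1), w))" if "l \<in> {0..<n}"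
  proof (cases "l = n - 1")
    case False
    then have "l + 1 \<in> {0..<n}" using that by auto
    then show ?thesis
      using False rot_z_F[OF that] oth_F(1)[of "l + 1"] by (simp add: fperm_def)
  qed (use rot_z_F[OF that] oth_C(2)[OF zero(1)] in \<open>simp add: fperm_def\<close>)
qed

lemma cyc_eq_2:
  fixes pos pos' :: "'e \<times> 'v \<Rightarrow> int"
  assumes "darts G = A \<union> B" "A \<inter> B = {}" "A \<noteq> {}" "B \<noteq> {}"
    and "\<And>d. d \<in> A \<Longrightarrow> fperm G d \<in> A" "\<And>d. d \<in> A \<Longrightarrow> pos d \<in> {0..<K}"
      "\<And>d. d \<in> A \<Longrightarrow> pos (fperm G d) = (pos d + 1) mod K" "inj_on pos A"
    and "\<And>d. d \<in> B \<Longrightarrow> fperm G d \<in> B" "\<And>d. d \<in> B \<Longrightarrow> pos' d \<in> {0..<L}"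
      "\<And>d. d \<in> B \<Longrightarrow> pos' (fperm G d) = (pos' d + 1) mod L" "inj_on pos' B"
  shows "cyc G = 2"
  unfolding cyc_def assms(1)
proof (rule card_two_orbits)
  show "{(fperm G ^^ k) d | k. True} = A" if "d \<in> A" for d
    using orbit_cyclic[OF assms(5-8) that] .
  show "{(fperm G ^^ k) d | k. True} = B" if "d \<in> B" for d
    using orbit_cyclic[OF assms(9-12) that] .
qed (rule assms(2-4))+

lemma card_edges: "int (card (edges G)) = m + n"
proof -
  have "card (edges G) = card (C ` {0..<m}) + card (F ` {0..<n})"
    unfolding edges_eq using disjoint by (intro card_Un_disjoint) simp_all
  then show ?thesis using m_pos n_pos by (simp add: card_image[OF inj_C] card_image[OF inj_F])
qed

lemma card_verts: "card (verts G) = 3"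
  unfolding verts_eq using distinct_verts by simp

lemma F_neq_C: "k \<in> {0..<m} \<Longrightarrow> l \<in> {0..<n} \<Longrightarrow> F l \<noteq> C k"
  using C_neq_F by metis

text \<open>The short face runs between the consecutive edges \<open>C 0\<close> and
  \<open>C 1\<close>. The other passes through \<open>F\<close> twice, alternating between
  \<open>w\<close> and \<open>z\<close>: since \<open>n\<close> is odd, a first pass begun at
  \<open>w\<close> also ends at \<open>w\<close> and continues at \<open>F 0\<close> with the ends
  exchanged. The first pass meets even indices at \<open>w\<close> and odd ones at \<open>z\<close>;
  on the second, \<open>pos\<close> is larger by \<open>n\<close>.\<close>

lemma cyc_double:
  assumes "m = 2" "odd n"
  shows "cyc G = 2"
proof -
  have k01: "0 \<in> {0..<m}" "1 \<in> {0..<m}" "k \<in> {0..<m} \<longleftrightarrow> k = 0 \<or> k = 1" for k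
    using assms(1) by auto
  have C01: "C 0 \<noteq> C 1" using C_eq_iff[OF k01(1,2)] by simp
  have zero: "0 \<in> {0..<n}" using n_pos by simp
  have last: "even (n - 1)" using assms(2) by simp
  let ?A = "{(C 0, z), (C 1, v)}"
  let ?B = "{(C 1, z), (C 0, v)} \<union> (\<lambda>l. (F l, z)) ` {0..<n} \<union> (\<lambda>l. (F l, w)) ` {0..<n}"
  define pos where "pos d = (if d = (C 1, z) then 0 else if d = (C 0, v) then 2 * n + 1
      else if (snd d = w) = even (idx_F (fst d)) then idx_F (fst d) + 1 else n + idx_F (fst d) + 1)" for d
  have pos_simps: "pos (C 1, z) = 0" "pos (C 0, v) = 2 * n + 1"
    "l \<in> {0..<n} \<Longrightarrow> pos (F l, w) = (if even l then l + 1 else n + l + 1)"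
    "l \<in> {0..<n} \<Longrightarrow> pos (F l, z) = (if even l then n + l + 1 else l + 1)" for l
    using distinct_verts F_neq_C[OF k01(1), of l] F_neq_C[OF k01(2), of l] unfolding pos_def by auto
  have fp: "fperm G (C 0, z) = (C 1, v)" "fperm G (C 1, v) = (C 0, z)"
    "fperm G (C 1, z) = (F 0, w)" "fperm G (C 0, v) = (C 1, z)"
    using fperm_simps(1,2)[OF k01(1)] fperm_simps(1,2)[OF k01(2)] assms(1) by simp_all
  have B_cases: thesis
    if "d \<in> ?B" "d = (C 1, z) \<Longrightarrow> thesis" "d = (C 0, v) \<Longrightarrow> thesis"
      "\<And>l. l \<in> {0..<n} \<Longrightarrow> d = (F l, z) \<Longrightarrow> thesis" "\<And>l. l \<in> {0..<n} \<Longrightarrow> d = (F l, w) \<Longrightarrow> thesis"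
    for d thesis using that by blast
  have step: "fperm G d \<in> ?B \<and> pos d \<in> {0..<2 + 2 * n} \<and> pos (fperm G d) = (pos d + 1) mod (2 + 2 * n)"
    if "d \<in> ?B" for d
    using that
  proof (rule B_cases)
    assume d: "d = (C 1, z)"
    show ?thesis unfolding d fp pos_simps pos_simps(3)[OF zero] using zero by simp
  next
    assume d: "d = (C 0, v)"
    show ?thesis unfolding d fp pos_simps using n_pos by simp
  next
    fix l assume l: "l \<in> {0..<n}" and d: "d = (F l, z)"
    show ?thesis
    proof (cases "l = n - 1")
      case True
      then show ?thesis
        unfolding d fperm_simps(3)[OF l] pos_simps(4)[OF l] using last n_pos
        by (simp add: pos_simps)
    next
      case False
      then have l1: "l + 1 \<in> {0..<n}" using l by auto
      show ?thesis
        unfolding d fperm_simps(3)[OF l] pos_simps(4)[OF l] using False l l1 pos_simps(3)[OF l1] by simp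
    qed
  next
    fix l assume l: "l \<in> {0..<n}" and d: "d = (F l, w)"
    show ?thesis
    proof (cases "l = n - 1")
      case True
      then show ?thesis
        unfolding d fperm_simps(4)[OF l] pos_simps(3)[OF l] mod_succ[OF l] using last n_pos pos_simps(4)[OF zero] zero
        by simp
    next
      case False
      then have l1: "l + 1 \<in> {0..<n}" using l by auto
      have "(n + l + 1 + 1) mod (2 + 2 * n) = n + l + 1 + 1" using l by (intro mod_pos_pos_trivial) auto
      then show ?thesis
        unfolding d fperm_simps(4)[OF l] pos_simps(3)[OF l] mod_succ[OF l] using False l l1 pos_simps(4)[OF l1] by simp
    qed
  qed
  show ?thesis
  proof (rule cyc_eq_2)
    show "darts G = ?A \<union> ?B"
      unfolding darts_eq using assms(1) k01(3) by (auto simp del: atLeastLessThan_iff)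
    show "?A \<inter> ?B = {}"
      using C01 distinct_verts F_neq_C[OF k01(1)] F_neq_C[OF k01(2)] by (auto simp del: atLeastLessThan_iff dest: sym)
    let ?pos = "\<lambda>d. if d = (C 0, z) then 0 else 1 :: int"
    show "\<And>d. d \<in> ?A \<Longrightarrow> fperm G d \<in> ?A" using fp by auto
    show "\<And>d. d \<in> ?A \<Longrightarrow> ?pos d \<in> {0..<2}" by auto
    show "\<And>d. d \<in> ?A \<Longrightarrow> ?pos (fperm G d) = (?pos d + 1) mod 2" using fp C01 by auto
    show "inj_on ?pos ?A" by (auto simp: inj_on_def)
    show "inj_on pos ?B"
    proof (rule inj_onI)
      fix d d' assume d: "d \<in> ?B" and d': "d' \<in> ?B" and eq: "pos d = pos d'"
      show "d = d'"
        using d by (rule B_cases; use d' in \<open>rule B_cases\<close>; use eq last n_pos in \<open>auto simp: pos_simps split: if_splits\<close>)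
    qed
  qed (use step in blast)+
qed

text \<open>For even \<open>n\<close>, a pass through \<open>F\<close> begun at \<open>w\<close>
  ends at \<open>z\<close>, so the half-edges of \<open>F\<close> split by parity between two faces.
  One closes up through both sides of \<open>C 0\<close>, the other directly from
  \<open>F (n - 1)\<close> to \<open>F 0\<close>.\<close>

lemma cyc_single:
  assumes "m = 1" "even n"
  shows "cyc G = 2"
proof -
  have k0: "0 \<in> {0..<m}" "k \<in> {0..<m} \<longleftrightarrow> k = 0" for k
    using assms(1) by auto
  have zero: "0 \<in> {0..<n}" using n_pos by simp
  have last: "odd (n - 1)" using assms(2) by simp
  let ?A = "{(C 0, z), (C 0, v)} \<union> (\<lambda>l. (F l, z)) ` {l \<in> {0..<n}. odd l} \<union> (\<lambda>l. (F l, w)) ` {l \<in> {0..<n}. even l}"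
  let ?B = "(\<lambda>l. (F l, z)) ` {l \<in> {0..<n}. even l} \<union> (\<lambda>l. (F l, w)) ` {l \<in> {0..<n}. odd l}"
  define pos where "pos d = (if d = (C 0, z) then 0 else if d = (C 0, v) then n + 1
      else idx_F (fst d) + 1)" for d
  have pos_simps: "pos (C 0, z) = 0" "pos (C 0, v) = n + 1"
    "l \<in> {0..<n} \<Longrightarrow> pos (F l, y) = l + 1" for l y
    using distinct_verts F_neq_C[OF k0(1), of l] unfolding pos_def by auto
  have fp: "fperm G (C 0, z) = (F 0, w)" "fperm G (C 0, v) = (C 0, z)"
    using fperm_simps(1,2)[OF k0(1)] assms(1) by simp_all
  have A_cases: thesis
    if "d \<in> ?A" "d = (C 0, z) \<Longrightarrow> thesis" "d = (C 0, v) \<Longrightarrow> thesis"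
      "\<And>l. l \<in> {0..<n} \<Longrightarrow> odd l \<Longrightarrow> d = (F l, z) \<Longrightarrow> thesis"
      "\<And>l. l \<in> {0..<n} \<Longrightarrow> even l \<Longrightarrow> d = (F l, w) \<Longrightarrow> thesis"
    for d thesis using that by blast
  have step: "fperm G d \<in> ?A \<and> pos d \<in> {0..<2 + n} \<and> pos (fperm G d) = (pos d + 1) mod (2 + n)"
    if "d \<in> ?A" for d
    using that
  proof (rule A_cases)
    assume d: "d = (C 0, z)"
    show ?thesis unfolding d fp pos_simps pos_simps(3)[OF zero] using zero by simp
  next
    assume d: "d = (C 0, v)"
    show ?thesis unfolding d fp pos_simps using n_pos by simp
  next
    fix l assume l: "l \<in> {0..<n}" and o: "odd l" and d: "d = (F l, z)"
    show ?thesis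
    proof (cases "l = n - 1")
      case True
      then show ?thesis
        unfolding d fperm_simps(3)[OF l] pos_simps(3)[OF l] using n_pos by (simp add: pos_simps)
    next
      case False
      then have l1: "l + 1 \<in> {0..<n}" using l by auto
      show ?thesis
        unfolding d fperm_simps(3)[OF l] pos_simps(3)[OF l] using False l o l1 pos_simps(3)[OF l1] by simp
    qed
  next
    fix l assume l: "l \<in> {0..<n}" and o: "even l" and d: "d = (F l, w)"
    then have "l \<noteq> n - 1" using last by auto
    then have l1: "l + 1 \<in> {0..<n}" "l + 1 \<noteq> n" using l by auto
    show ?thesis
      unfolding d fperm_simps(4)[OF l] pos_simps(3)[OF l] mod_succ[OF l]
      using l o l1 pos_simps(3)[OF l1(1)] by simp
  qed
  have step': "fperm G d \<in> ?B \<and> idx_F (fst d) \<in> {0..<n}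
      \<and> idx_F (fst (fperm G d)) = (idx_F (fst d) + 1) mod n" if "d \<in> ?B" for d
    using that
  proof
    assume "d \<in> (\<lambda>l. (F l, z)) ` {l \<in> {0..<n}. even l}"
    then obtain l where l: "l \<in> {0..<n}" "even l" and d: "d = (F l, z)" by blast
    then have "l \<noteq> n - 1" using last by auto
    then have l1: "l + 1 \<in> {0..<n}" "l + 1 \<noteq> n" using l by auto
    then show ?thesis unfolding d fperm_simps(3)[OF l(1)] using l by simp
  next
    assume "d \<in> (\<lambda>l. (F l, w)) ` {l \<in> {0..<n}. odd l}"
    then obtain l where l: "l \<in> {0..<n}" "odd l" and d: "d = (F l, w)" by blast
    have "even ((l + 1) mod n)" using l assms(2) by (simp add: mod_succ)
    then show ?thesis unfolding d fperm_simps(4)[OF l(1)] fst_conv idx_F[OF mod_n] idx_F[OF l(1)]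
      using l mod_n by blast
  qed
  show ?thesis
  proof (rule cyc_eq_2)
    show "darts G = ?A \<union> ?B"
      unfolding darts_eq using assms(1) k0(2) by (auto simp del: atLeastLessThan_iff)
    show "?A \<inter> ?B = {}"
      using distinct_verts F_neq_C[OF k0(1)] F_eq_iff by (auto simp del: atLeastLessThan_iff dest: sym)
    show "?B \<noteq> {}" using zero by force
    show "inj_on pos ?A"
    proof (rule inj_onI)
      fix d d' assume d: "d \<in> ?A" and d': "d' \<in> ?A" and eq: "pos d = pos d'"
      show "d = d'"
        using d by (rule A_cases; use d' in \<open>rule A_cases\<close>; use eq n_pos in \<open>auto simp: pos_simps\<close>)
    qed
    show "inj_on (\<lambda>d. idx_F (fst d)) ?B"
      by (rule inj_onI) (auto simp del: atLeastLessThan_iff)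
  qed (use step step' in blast)+
qed

lemma has_genus_iff:
  assumes "cyc G = 2"
  shows "has_genus G g \<longleftrightarrow> 2 * g = m + n - 3"
  unfolding has_genus_def assms card_edges card_verts by auto

end

section \<open>Normal form of the ribbon graphs in the theorem\<close>

text \<open>\<open>FS\<close> is numbered along the rotation at \<open>w\<close>, starting with the
  edge after \<open>C (m - 1)\<close> at \<open>z\<close>. Restricting the rotation at
  \<open>z\<close> to \<open>FS\<close> cuts out the one block \<open>C\<close>, so outside this
  block it must agree with the rotation at \<open>w\<close>.\<close>

lemma banana_chain_exists:
  fixes G :: "('v, 'e) rgraph" and C :: "int \<Rightarrow> 'e"
  assumes ribbon: "ribbon G" and vs: "v \<noteq> z" "z \<noteq> w" "v \<noteq> w" "verts G = {v, z, w}"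
    and m_pos: "0 < m" and FS: "finite FS" "FS \<noteq> {}"
    and edges: "edges G = C ` {0..<m} \<union> FS" and disj: "C ` {0..<m} \<inter> FS = {}"
    and inj_C: "inj_on C {0..<m}"
    and ends_C: "\<And>k. k \<in> {0..<m} \<Longrightarrow> endpts G (C k) = {v, z}"
    and ends_F: "\<And>e. e \<in> FS \<Longrightarrow> endpts G e = {z, w}"
    and rot_v: "\<And>k. k \<in> {0..<m} \<Longrightarrow> rot G v (C k) = C ((k + 1) mod m)"
    and rot_z: "\<And>k. k \<in> {0..<m} \<Longrightarrow> k \<noteq> m - 1 \<Longrightarrow> rot G z (C k) = C (k + 1)"
    and restr: "\<And>e. e \<in> FS \<Longrightarrow> restrict_rot (rot G z) FS e = rot G w e"
  shows "\<exists>F. banana_chain G v z w m (int (card FS)) C F"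
proof -
  have inc_z: "inc G z = C ` {0..<m} \<union> FS" and inc_w: "inc G w = FS"
    using edges ends_C ends_F vs unfolding inc_def by auto
  have bij: "bij_betw (rot G z) (inc G z) (inc G z)" "bij_betw (rot G w) (inc G w) (inc G w)"
    and trans: "\<And>e e'. e \<in> inc G z \<Longrightarrow> e' \<in> inc G z \<Longrightarrow> \<exists>k. (rot G z ^^ k) e = e'"
      "\<And>e e'. e \<in> inc G w \<Longrightarrow> e' \<in> inc G w \<Longrightarrow> \<exists>k. (rot G w ^^ k) e = e'"
    using ribbon vs(4) unfolding ribbon_def by auto
  have z_inj: "e = e'" if "rot G z e = rot G z e'" "e \<in> inc G z" "e' \<in> inc G z" for e e'
    using that bij(1) unfolding bij_betw_def by (auto dest: inj_onD)
  have z_closed: "rot G z e \<in> inc G z" if "e \<in> inc G z" for e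
    using that bij(1) unfolding bij_betw_def by blast
  have w_closed: "rot G w e \<in> FS" if "e \<in> FS" for e
    using that bij(2) unfolding bij_betw_def inc_w by blast
  have C_inc: "C k \<in> inc G z" if "k \<in> {0..<m}" for k using that unfolding inc_z by blast
  have last: "m - 1 \<in> {0..<m}" and zero: "0 \<in> {0..<m}" using m_pos by auto
  have pred: "e = C (k - 1)" if "rot G z e = C k" "e \<in> inc G z" "k \<in> {0..<m}" "k \<noteq> 0" for e k
  proof -
    have "k - 1 \<in> {0..<m}" "k - 1 \<noteq> m - 1" using that by auto
    then have "rot G z (C (k - 1)) = rot G z e" using rot_z[of "k - 1"] that by simp
    then show ?thesis using z_inj that(2) C_inc[OF \<open>k - 1 \<in> {0..<m}\<close>] by metis
  qed
  define F0 where "F0 = rot G z (C (m - 1))"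
  have F0: "F0 \<in> FS"
  proof (rule ccontr)
    assume "F0 \<notin> FS"
    then obtain k where k: "k \<in> {0..<m}" "F0 = C k"
      using z_closed[OF C_inc[OF last]] unfolding F0_def inc_z by blast
    have "k = 0"
    proof (rule ccontr)
      assume "k \<noteq> 0"
      then have "C (m - 1) = C (k - 1)" using pred[OF _ C_inc[OF last] k(1)] k(2) F0_def by simp
      moreover have "k - 1 \<in> {0..<m}" using k \<open>k \<noteq> 0\<close> by auto
      ultimately have "m - 1 = k - 1" using inj_C last by (auto dest: inj_onD)
      then show False using k by auto
    qed
    \<comment> \<open>If \<open>C (m - 1)\<close> were followed by \<open>C 0\<close>, then
      \<open>C\<close> would be closed under the rotation at \<open>z\<close>, against
      transitivity.\<close>
    have "(rot G z ^^ t) (C 0) \<in> C ` {0..<m}" for t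
    proof (induction t)
      case (Suc t)
      then obtain k' where k': "k' \<in> {0..<m}" "(rot G z ^^ t) (C 0) = C k'" by blast
      show ?case
      proof (cases "k' = m - 1")
        case True
        then show ?thesis using k' k F0_def by simp
      next
        case False
        then have "k' + 1 \<in> {0..<m}" using k' by auto
        then show ?thesis using k' rot_z[OF k'(1) False] by simp
      qed
    qed (use zero in simp)
    moreover obtain e where "e \<in> FS" using FS by blast
    then obtain t where "(rot G z ^^ t) (C 0) = e" using trans(1)[OF C_inc[OF zero], of e] inc_z by blast
    ultimately show False using disj \<open>e \<in> FS\<close> by (metis IntI empty_iff)
  qed
  define n where "n = int (card FS)"
  have n_pos: "n > 0" unfolding n_def using FS by (simp add: card_gt_0_iff)
  define F where "F l = (rot G w ^^ nat l) F0" for l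
  note cyc = funpow_transitive_enum[of FS "rot G w", OF trans(2)[unfolded inc_w] w_closed F0]
  have nat_im: "nat ` {0..<n} = {..<card FS}"
  proof
    show "{..<card FS} \<subseteq> nat ` {0..<n}"
    proof
      fix t assume "t \<in> {..<card FS}"
      then have "int t \<in> {0..<n}" "t = nat (int t)" unfolding n_def by auto
      then show "t \<in> nat ` {0..<n}" by blast
    qed
  qed (auto simp: n_def)
  have F_im: "F ` {0..<n} = FS"
    using cyc(2) unfolding nat_im[symmetric] image_image F_def .
  have inj_F: "inj_on F {0..<n}"
  proof (rule inj_onI)
    fix a b assume ab: "a \<in> {0..<n}" "b \<in> {0..<n}" "F a = F b"
    then have "nat a = nat b"
      using inj_onD[OF cyc(1), of "nat a" "nat b"] unfolding F_def n_def by auto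
    then show "a = b" using ab by auto
  qed
  have F_in: "F l \<in> FS" if "l \<in> {0..<n}" for l using F_im that by blast
  have F_0: "F 0 = F0" unfolding F_def by simp
  have rot_w: "rot G w (F l) = F ((l + 1) mod n)" if l: "l \<in> {0..<n}" for l
  proof -
    have "rot G w (F l) = (rot G w ^^ nat (l + 1)) F0"
      using l unfolding F_def by (simp add: nat_add_distrib)
    then show ?thesis
      using cyc(3) unfolding mod_succ[OF l] by (auto simp: F_0 F_def n_def)
  qed
  have rot_z_F: "rot G z (F l) = (if l = n - 1 then C 0 else F (l + 1))" if l: "l \<in> {0..<n}" for l
  proof -
    let ?e = "F l"
    have e: "?e \<in> FS" "?e \<in> inc G z" using F_in[OF l] inc_z by auto
    have e_ne: "?e \<noteq> C k" if "k \<in> {0..<m}" for k using e disj that by blast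
    show ?thesis
    proof (cases "rot G z ?e \<in> FS")
      case True
      \<comment> \<open>A successor inside \<open>FS\<close> is reached in one step, so there the
        restricted rotation is the rotation itself.\<close>
      have "(LEAST t. t > 0 \<and> (rot G z ^^ t) ?e \<in> FS) = 1"
        by (rule Least_equality) (use True in auto)
      then have eq: "rot G z ?e = F ((l + 1) mod n)"
        using restr[OF e(1)] rot_w[OF l] unfolding restrict_rot_def by simp
      have "l \<noteq> n - 1"
      proof
        assume "l = n - 1"
        then have "rot G z ?e = rot G z (C (m - 1))" using eq F_0 F0_def by simp
        then show False using z_inj e(2) C_inc[OF last] e_ne[OF last] by blast
      qed
      then show ?thesis using eq mod_succ[OF l] by simp
    next
      case False
      then obtain k where k: "k \<in> {0..<m}" "rot G z ?e = C k"
        using z_closed[OF e(2)] inc_z by blast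
      have "k = 0"
      proof (rule ccontr)
        assume "k \<noteq> 0"
        moreover from this have "k - 1 \<in> {0..<m}" using k by auto
        ultimately show False using pred[OF k(2) e(2) k(1)] e_ne by blast
      qed
      \<comment> \<open>A successor outside \<open>FS\<close> is \<open>C 0\<close>, every other
        \<open>C k\<close> being preceded by \<open>C (k - 1)\<close>. The rotation then crosses all
        of \<open>C\<close> and leaves at \<open>F0\<close>, so the restricted one takes
        \<open>m + 1\<close> steps and \<open>l\<close> is the last index.\<close>
      have pow: "(rot G z ^^ Suc t) ?e = C (int t)" if "int t < m" for t
        using that
      proof (induction t)
        case (Suc t)
        then have "rot G z (C (int t)) = C (int t + 1)" by (intro rot_z) auto
        then show ?case using Suc by (simp add: add.commute)
      qed (use k \<open>k = 0\<close> in simp)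
      have "(rot G z ^^ Suc (nat (m - 1))) ?e = C (m - 1)" using pow[of "nat (m - 1)"] m_pos by simp
      then have pow_last: "(rot G z ^^ Suc (Suc (nat (m - 1)))) ?e = F0" by (simp add: F0_def)
      have "(LEAST t. t > 0 \<and> (rot G z ^^ t) ?e \<in> FS) = Suc (Suc (nat (m - 1)))"
      proof (rule Least_equality)
        show "Suc (Suc (nat (m - 1))) > 0 \<and> (rot G z ^^ Suc (Suc (nat (m - 1)))) ?e \<in> FS"
          using pow_last F0 by simp
        fix t assume t: "t > 0 \<and> (rot G z ^^ t) ?e \<in> FS"
        show "Suc (Suc (nat (m - 1))) \<le> t"
        proof (rule ccontr)
          assume "\<not> Suc (Suc (nat (m - 1))) \<le> t"
          then have "t < Suc (Suc (nat (m - 1)))" by simp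
          moreover obtain t' where "t = Suc t'" using t gr0_implies_Suc by blast
          ultimately have t': "t = Suc t'" "int t' < m" using m_pos by linarith+
          then have "(rot G z ^^ t) ?e = C (int t')" using pow by blast
          moreover have "C (int t') \<in> C ` {0..<m}" using t' by auto
          ultimately show False using t disj by (metis IntI empty_iff)
        qed
      qed
      then have "F ((l + 1) mod n) = F 0"
        using restr[OF e(1)] rot_w[OF l] pow_last F_0 unfolding restrict_rot_def by simp
      then have "(l + 1) mod n = 0"
        using inj_F n_pos by (auto dest!: inj_onD)
      then have "l = n - 1" using mod_succ[OF l] l by (auto split: if_splits)
      then show ?thesis using k \<open>k = 0\<close> by simp
    qed
  qed
  have "banana_chain G v z w m n C F"
  proof
    show "rot G z (C k) = (if k = m - 1 then F 0 else C (k + 1))" if "k \<in> {0..<m}" for k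
      using rot_z[OF that] F_0 F0_def by auto
  qed (use assms n_pos F_im inj_F F_in rot_w rot_z_F in auto)
  then show ?thesis unfolding n_def by blast
qed

section \<open>Comparison of the two chains\<close>

locale banana_pair =
  G: banana_chain G v z w 2 X C F + G': banana_chain G' v z w 1 "2 * X" C' F'
  for G :: "('v, 'e) rgraph" and G' :: "('v, 'f) rgraph" and v z w X C F C' F' +
  assumes odd_X: "odd X"
begin

text \<open>This is the class of \<open>k (v - w)\<close>. All classes of degree zero have this form
  in both graphs, which makes \<open>k\<close> modulo \<open>2 * X\<close> a common
  coordinate.\<close>

definition cl :: "int \<Rightarrow> ('v \<Rightarrow> int) set" where "cl k = G.cls 0 k (- k)"
definition cl' :: "int \<Rightarrow> ('v \<Rightarrow> int) set" where "cl' k = G'.cls 0 k (- k)"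

lemma cl_eq_iff: "cl k = cl l \<longleftrightarrow> k mod (2 * X) = l mod (2 * X)"
  unfolding cl_def G.cls_eq_iff mod_uminus_eq_iff mod_2_times_odd_eq_iff[OF odd_X] ..

lemma cl'_eq_iff: "cl' k = cl' l \<longleftrightarrow> k mod (2 * X) = l mod (2 * X)"
  unfolding cl'_def G'.cls_eq_iff mod_uminus_eq_iff by simp

lemma Pic0_G: "Pic0 G = range cl"
proof -
  have "\<exists>k. G.cls 0 a b = cl k" for a b
  proof -
    obtain k where k: "k mod 2 = a mod 2" "k mod X = (- b) mod X"
      using mod_2_odd_solve[OF odd_X] by blast
    have "(- k) mod X = b mod X" using k(2) mod_uminus_eq_iff[of "- k" X b] by simp
    then show ?thesis unfolding cl_def G.cls_eq_iff using k(1) by metis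
  qed
  then show ?thesis unfolding G.Pic_eq using cl_def by blast
qed

lemma Pic0_G': "Pic0 G' = range cl'"
proof -
  have "G'.cls 0 a b = cl' (- b)" for a b
    unfolding cl'_def G'.cls_eq_iff by simp
  then show ?thesis unfolding G'.Pic_eq using cl'_def by blast
qed

lemma pic_add_cl: "pic_add (cl k) (cl l) = cl (k + l)" "pic_add (cl' k) (cl' l) = cl' (k + l)"
  unfolding cl_def cl'_def G.pic_add_cls G'.pic_add_cls by simp_all

lemma divisor_in_cl: "G.divisor 0 k (- k) \<in> cl k"
  unfolding cl_def by (rule G.divisor_in_cls) simp_all

lemma divisor_in_cl': "G'.divisor 0 k (- k) \<in> cl' k"
  unfolding cl'_def by (rule G'.divisor_in_cls) simp_all

text \<open>Any representative supported on \<open>{v, w}\<close> is a multiple of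
  \<open>v - w\<close> whose factor agrees with \<open>k\<close> modulo 2 and \<open>X\<close>,
  hence modulo \<open>2 * X\<close>; the choice in \<open>gam\<close> is harmless.\<close>

lemma gam_cl: "gam G G' {v, w} (cl k) = cl' k"
proof -
  define D where "D = (SOME D. D \<in> cl k \<and> supported_on {v, w} D)"
  have D: "D \<in> cl k" "supported_on {v, w} D"
    unfolding D_def using someI[of "\<lambda>D. D \<in> cl k \<and> supported_on {v, w} D"]
      divisor_in_cl G.supported_on_divisor by blast+
  note D' = G.supported_on_in_cls[OF D(2) D(1)[unfolded cl_def]]
  have "D v mod 2 = k mod 2" "D v mod X = k mod X"
    using D' mod_uminus_eq_iff by metis+
  then have "D v mod (2 * X) = k mod (2 * X)" using mod_2_times_odd_eq_iff[OF odd_X] by blast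
  moreover have "cdeg G' D = 0"
    using D(1) unfolding cl_def G.cls_def G.cdeg_eq G'.cdeg_eq by simp
  ultimately have "pcls G' D = cl' k"
    unfolding G'.pcls_eq cl'_def D'(2) by (simp add: G'.cls_eq_iff mod_uminus_eq_iff)
  then show ?thesis unfolding gam_def D_def .
qed

lemma property1: "property1 G G' {v, w}"
  unfolding property1_def Pic0_G Pic0_G'
  using divisor_in_cl divisor_in_cl' G.supported_on_divisor G'.supported_on_divisor by blast

lemma property2: "property2 G G' {v, w}"
  unfolding property2_def
  using G.linequiv_supported G'.linequiv_supported mod_2_times_odd_eq_iff[OF odd_X] by simp

lemma pic_iso_gam: "pic_iso G G' (gam G G' {v, w})"
  unfolding pic_iso_def bij_betw_def
proof (intro conjI ballI)
  show "inj_on (gam G G' {v, w}) (Pic0 G)"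
    unfolding Pic0_G
    by (rule inj_onI, elim rangeE) (simp only: gam_cl cl_eq_iff cl'_eq_iff)
  show "gam G G' {v, w} ` Pic0 G = Pic0 G'"
    unfolding Pic0_G Pic0_G' image_image gam_cl ..
  fix S R assume "S \<in> Pic0 G" "R \<in> Pic0 G"
  then show "gam G G' {v, w} (pic_add S R) = pic_add (gam G G' {v, w} S) (gam G G' {v, w} R)"
    unfolding Pic0_G by (auto simp: gam_cl pic_add_cl)
qed

text \<open>By the Chinese remainder theorem every tree of \<open>G\<close> has a diagonal index
  pair, unique modulo \<open>2 * X\<close>. In \<open>G'\<close> the first bundle has one edge, so
  any first index would do.\<close>

definition tree_map :: "'e set \<Rightarrow> 'f set" where
  "tree_map T = G'.tr 0 (SOME k. T = G.tr k k)"

lemma tree_map_tr: "tree_map (G.tr k k) = G'.tr 0 k"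
proof -
  define l where "l = (SOME l. G.tr k k = G.tr l l)"
  have "G.tr k k = G.tr l l" unfolding l_def by (rule someI[of _ k]) simp
  then have "k mod (2 * X) = l mod (2 * X)"
    unfolding G.tr_eq_iff mod_2_times_odd_eq_iff[OF odd_X] .
  then show ?thesis unfolding tree_map_def l_def[symmetric] G'.tr_eq_iff by simp
qed

lemma sptrees_G: "sptrees G = range (\<lambda>k. G.tr k k)"
proof -
  have "\<exists>k. G.tr a b = G.tr k k" for a b
    using mod_2_odd_solve[OF odd_X, of a b] unfolding G.tr_eq_iff by metis
  then show ?thesis unfolding G.sptrees_eq by blast
qed

lemma sptrees_G': "sptrees G' = range (G'.tr 0)"
proof -
  have "G'.tr a b = G'.tr 0 b" for a b unfolding G'.tr_eq_iff by simp
  then show ?thesis unfolding G'.sptrees_eq by blast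
qed

lemma bij_tree_map: "bij_betw tree_map (sptrees G) (sptrees G')"
  unfolding bij_betw_def sptrees_G sptrees_G' image_image tree_map_tr
proof
  show "inj_on tree_map (range (\<lambda>k. G.tr k k))"
    by (rule inj_onI, elim rangeE)
      (simp only: tree_map_tr G.tr_eq_iff G'.tr_eq_iff mod_2_times_odd_eq_iff[OF odd_X])
qed simp

text \<open>Here the size 2 of the first bundle is used: a reversed sign in its index is not seen,
  which repairs the mismatch for the root \<open>z\<close>.\<close>

lemma tr_parity: "G.tr (k + a) b = G.tr (k - a) b"
  unfolding G.tr_eq_iff mod_eq_dvd_iff by simp

lemma rotor_tree_map:
  assumes u: "u \<in> {v, z, w}" and S: "S \<in> Pic0 G" and T: "T \<in> sptrees G"
  shows "tree_map (rotor G u S T) = rotor G' u (gam G G' {v, w} S) (tree_map T)"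
proof -
  obtain a k where S: "S = cl a" and T: "T = G.tr k k" using S T unfolding Pic0_G sptrees_G by blast
  \<comment> \<open>For the root \<open>z\<close> the translation gives
    \<open>G.tr (k + a) (k - a)\<close>, and parity moves this back to the diagonal.\<close>
  have "rotor G v S T = G.tr (k - a) (k - a)" "rotor G z S T = G.tr (k - a) (k - a)"
    "rotor G w S T = G.tr (k + a) (k + a)"
    unfolding S T cl_def G.rotor_v G.rotor_z G.rotor_w by (simp_all add: tr_parity[of k a "k - a"])
  moreover have "rotor G' v (cl' a) (G'.tr 0 k) = G'.tr 0 (k - a)"
    "rotor G' z (cl' a) (G'.tr 0 k) = G'.tr 0 (k - a)" "rotor G' w (cl' a) (G'.tr 0 k) = G'.tr 0 (k + a)"
    unfolding cl'_def G'.rotor_v G'.rotor_z G'.rotor_w by (simp_all add: G'.tr_eq_iff)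
  ultimately show ?thesis
    using u unfolding S T gam_cl tree_map_tr by (elim insertE emptyE; simp only: tree_map_tr)
qed

lemma bern_tree_map:
  assumes u: "u \<in> {v, z, w}" and e0: "e0 \<in> inc G u" "e0' \<in> inc G' u"
    and S: "S \<in> Pic0 G" and T: "T \<in> sptrees G"
  shows "tree_map (bern G u e0 S T) = bern G' u e0' (gam G G' {v, w} S) (tree_map T)"
proof -
  obtain a k where S: "S = cl a" and T: "T = G.tr k k" using S T unfolding Pic0_G sptrees_G by blast
  consider "u = v" | "u = z" | "u = w" using u by blast
  then show ?thesis
  proof cases
    case 1
    have "bern G v e0 S T = G.tr (k + a) (k + a)"
      unfolding S T cl_def G.bern_v[OF e0(1)[unfolded 1]] by simp
    moreover have "bern G' v e0' (cl' a) (G'.tr 0 k) = G'.tr 0 (k + a)"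
      unfolding cl'_def G'.bern_v[OF e0(2)[unfolded 1]] by (simp add: G'.tr_eq_iff)
    ultimately show ?thesis unfolding 1 S T gam_cl tree_map_tr by (simp only: tree_map_tr)
  next
    case 2
    have "bern G z e0 S T = G.tr (k + a) (k + a)"
      unfolding S T cl_def G.bern_z[OF e0(1)[unfolded 2]] by (simp add: tr_parity[symmetric])
    moreover have "bern G' z e0' (cl' a) (G'.tr 0 k) = G'.tr 0 (k + a)"
      unfolding cl'_def G'.bern_z[OF e0(2)[unfolded 2]] by (simp add: G'.tr_eq_iff)
    ultimately show ?thesis unfolding 2 S T gam_cl tree_map_tr by (simp only: tree_map_tr)
  next
    case 3
    have "bern G w e0 S T = G.tr (k - a) (k - a)"
      unfolding S T cl_def G.bern_w[OF e0(1)[unfolded 3]] by simp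
    moreover have "bern G' w e0' (cl' a) (G'.tr 0 k) = G'.tr 0 (k - a)"
      unfolding cl'_def G'.bern_w[OF e0(2)[unfolded 3]] by (simp add: G'.tr_eq_iff)
    ultimately show ?thesis unfolding 3 S T gam_cl tree_map_tr by (simp only: tree_map_tr)
  qed
qed

lemma genus: "has_genus G g \<longleftrightarrow> 2 * g = X - 1" "has_genus G' g \<longleftrightarrow> 2 * g = 2 * X - 2"
  using G.has_genus_iff[OF G.cyc_double[OF refl odd_X]] G'.has_genus_iff[OF G'.cyc_single[OF refl]]
  by auto

end

theorem theorem3p7:
  fixes G :: "('v, 'e) rgraph" and G' :: "('v, 'f) rgraph"
    and v z w :: 'v and g x :: nat
    and c1 c2 :: 'e and f :: "nat \<Rightarrow> 'e"
    and c :: 'f and h :: "nat \<Rightarrow> 'f"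
  assumes g_pos: "g > 0" and x_def: "x = 2 * g + 1"
    and distinct_vs: "v \<noteq> z" "z \<noteq> w" "v \<noteq> w"
    and G_ribbon: "ribbon G"
    and G_verts: "verts G = {v, z, w}"
    and G_edges: "edges G = {c1, c2} \<union> f ` {1..x}"
    and G_c: "c1 \<noteq> c2" "c1 \<notin> f ` {1..x}" "c2 \<notin> f ` {1..x}"
    and G_f_inj: "inj_on f {1..x}"
    and G_c_ends: "endpts G c1 = {v, z}" "endpts G c2 = {v, z}"
    and G_f_ends: "\<forall>i\<in>{1..x}. endpts G (f i) = {z, w}"
    and G_consec: "rot G z c1 = c2 \<or> rot G z c2 = c1"
    and G_restr: "\<forall>e\<in>f ` {1..x}. restrict_rot (rot G z) (f ` {1..x}) e = rot G w e"
    and G'_ribbon: "ribbon G'"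
    and G'_verts: "verts G' = {v, z, w}"
    and G'_edges: "edges G' = {c} \<union> h ` {1..2*x}"
    and G'_c: "c \<notin> h ` {1..2*x}"
    and G'_h_inj: "inj_on h {1..2*x}"
    and G'_c_ends: "endpts G' c = {v, z}"
    and G'_h_ends: "\<forall>i\<in>{1..2*x}. endpts G' (h i) = {z, w}"
    and G'_restr: "\<forall>e\<in>h ` {1..2*x}. restrict_rot (rot G' z) (h ` {1..2*x}) e = rot G' w e"
  shows "(\<exists>\<psi>. pic_iso G G' \<psi>)
    \<and> property1 G G' {v, w} \<and> property2 G G' {v, w}
    \<and> pic_iso G G' (gam G G' {v, w})
    \<and> (\<exists>\<phi>. bij_betw \<phi> (sptrees G) (sptrees G')
         \<and> (\<forall>u\<in>{v, z, w}. \<forall>S\<in>Pic0 G. \<forall>T\<in>sptrees G.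
               \<phi> (rotor G u S T) = rotor G' u (gam G G' {v, w} S) (\<phi> T))
         \<and> (\<forall>u\<in>{v, z, w}. \<forall>e0\<in>inc G u. \<forall>e0'\<in>inc G' u. \<forall>S\<in>Pic0 G. \<forall>T\<in>sptrees G.
               \<phi> (bern G u e0 S T) = bern G' u e0' (gam G G' {v, w} S) (\<phi> T)))
    \<and> has_genus G (int g) \<and> has_genus G' (2 * int g)"
proof -
  define X where "X = int x"
  have X: "odd X" unfolding X_def x_def by simp
  have x_pos: "x > 0" unfolding x_def by simp
  \<comment> \<open>Either of \<open>c1\<close>, \<open>c2\<close> may come first at
    \<open>z\<close>; the names \<open>a\<close>, \<open>b\<close> follow the rotation there. At
    \<open>v\<close> the rotation swaps the two edges in any case.\<close>
  obtain a b where ab: "{a, b} = {c1, c2}" "a \<noteq> b" "rot G z a = b"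
    using G_consec G_c(1) by (metis insert_commute)
  define C where "C k = (if k = 0 then a else b)" for k :: int
  have two: "{0..<2} = {0, 1 :: int}" and one: "{0..<1} = {0 :: int}" by auto
  have C_im: "C ` {0..<2} = {c1, c2}" unfolding two ab(1)[symmetric] C_def by auto
  have ab_ends: "endpts G a = {v, z}" "endpts G b = {v, z}"
    using ab(1) G_c_ends by (auto simp: doubleton_eq_iff)
  have inc_v: "inc G v = {a, b}"
    using G_edges ab_ends G_f_ends distinct_vs ab(1) unfolding inc_def by auto
  have v_in: "v \<in> verts G" "v \<in> verts G'" using G_verts G'_verts by auto
  have rot_v: "rot G v a = b" "rot G v b = a"
    using rot_pair[OF G_ribbon v_in(1) inc_v ab(2)]
      rot_pair[OF G_ribbon v_in(1) inc_v[unfolded insert_commute[of a]] ab(2)[symmetric]] .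
  have "\<exists>F. banana_chain G v z w 2 (int (card (f ` {1..x}))) C F"
  proof (rule banana_chain_exists)
    show "edges G = C ` {0..<2} \<union> f ` {1..x}" using G_edges C_im by simp
    show "C ` {0..<2} \<inter> f ` {1..x} = {}" using C_im G_c by auto
    show "inj_on C {0..<2}" unfolding two C_def using ab(2) by (simp add: inj_on_def)
    show "endpts G (C k) = {v, z}" for k unfolding C_def using ab_ends by simp
    show "rot G v (C k) = C ((k + 1) mod 2)" if "k \<in> {0..<2}" for k
      using that rot_v unfolding two C_def by auto
    show "rot G z (C k) = C (k + 1)" if "k \<in> {0..<2}" "k \<noteq> 2 - 1" for k
      using that ab(3) unfolding two C_def by auto
  qed (use G_ribbon distinct_vs G_verts G_f_ends G_restr x_pos in auto)
  moreover have "int (card (f ` {1..x})) = X" unfolding card_image[OF G_f_inj] X_def by simp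
  ultimately obtain F where F: "banana_chain G v z w 2 X C F" by auto
  have inc_v': "inc G' v = {c}"
    using G'_edges G'_c_ends G'_h_ends distinct_vs unfolding inc_def by auto
  have rot_v': "rot G' v c = c"
    using ribbon_rot_trans(1)[OF G'_ribbon v_in(2), of c] inc_v' by auto
  have "\<exists>F. banana_chain G' v z w 1 (int (card (h ` {1..2*x}))) (\<lambda>_. c) F"
  proof (rule banana_chain_exists)
    show "edges G' = (\<lambda>_. c) ` {0..<1 :: int} \<union> h ` {1..2*x}" using G'_edges unfolding one by simp
    show "(\<lambda>_. c) ` {0..<1 :: int} \<inter> h ` {1..2*x} = {}" using G'_c unfolding one by simp
    show "inj_on (\<lambda>_. c) {0..<1 :: int}" unfolding one by simp
  qed (use G'_ribbon distinct_vs G'_verts G'_h_ends G'_c_ends rot_v' G'_restr x_pos in auto)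
  moreover have "int (card (h ` {1..2*x})) = 2 * X" unfolding card_image[OF G'_h_inj] X_def by simp
  ultimately obtain F' where F': "banana_chain G' v z w 1 (2 * X) (\<lambda>_. c) F'" by auto
  interpret banana_pair G G' v z w X C F "\<lambda>_. c" F'
    using F F' X by (simp add: banana_pair_def banana_pair_axioms_def)
  have genera: "has_genus G (int g)" "has_genus G' (2 * int g)"
    unfolding genus X_def x_def by simp_all
  show ?thesis
    by (intro conjI exI[of _ "gam G G' {v, w}"] exI[of _ tree_map] ballI pic_iso_gam property1
        property2 bij_tree_map rotor_tree_map bern_tree_map genera)
qed

end
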